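(* Let $\sigma>0$. For all $n\ge2$ and any $\mu\in\mathbb{R}^n$, with $y=\mu+\xi$, $\xi\sim\mathcal{N}(0,\sigma^2I_{n\times n})$, $$\mathbb{E}\,\|\hat\mu^{LS}(\mathcal{S}_n^\uparrow)-\mu\|^2\le\min_{u\in\mathcal{S}_n^\uparrow}\left(\|u-\mu\|^2+\frac{\sigma^2k(u)}{n}\log\frac{en}{k(u)}\right).$$ Furthermore, for any $x>0$, with probability greater than $1-\exp(-x)$, $$\|\hat\mu^{LS}(\mathcal{S}_n^\uparrow)-\mu\|^2\le\min_{u\in\mathcal{S}_n^\uparrow}\left(\|u-\mu\|^2+\frac{2\sigma^2k(u)}{n}\log\frac{en}{k(u)}\right)+\frac{4\sigma^2x}{n}.$$
   Context: Scaled norm: $\|v\|^2=\frac1n\sum_{i=1}^n v_i^2$ for $v\in\mathbb{R}^n$. $\mathcal{S}_n^\uparrow=\{u\in\mathbb{R}^n: u_i\le u_{i+1},\ i=1,\dots,n-1\}$. For $u\in\mathcal{S}_n^\uparrow$, $k(u)\ge1$ is the integer such that $k(u)-1$ is the number of indices $i\in\{1,\dots,n-1\}$ with $u_i<u_{i+1}$. The least squares estimator over a nonempty closed set $K$ is $\hat\mu^{LS}(K)\in\operatorname{argmin}_{v\in K}\|y-v\|^2$. *)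

theory Defs
  imports "HOL-Probability.Probability"
begin

(* Vectors of R^n are functions on the index set {1..n}, extended by undefined elsewhere,
   so that Rn n is also the space of the product sigma-algebra over {1..n}. *)
definition Rn :: "nat \<Rightarrow> (nat \<Rightarrow> real) set" where
  "Rn n = {1..n} \<rightarrow>\<^sub>E UNIV"

definition scaled_norm :: "nat \<Rightarrow> (nat \<Rightarrow> real) \<Rightarrow> real" where
  "scaled_norm n v = sqrt ((1 / real n) * (\<Sum>i=1..n. (v i)\<^sup>2))"

definition monotone_cone :: "nat \<Rightarrow> (nat \<Rightarrow> real) set" where
  "monotone_cone n = {u \<in> Rn n. \<forall>i\<in>{1..n-1}. u i \<le> u (i + 1)}"

definition num_pieces :: "nat \<Rightarrow> (nat \<Rightarrow> real) \<Rightarrow> nat" where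
  "num_pieces n u = card {i \<in> {1..n-1}. u i < u (i + 1)} + 1"

definition is_least_squares ::
  "nat \<Rightarrow> (nat \<Rightarrow> real) set \<Rightarrow> (nat \<Rightarrow> real) \<Rightarrow> (nat \<Rightarrow> real) \<Rightarrow> bool" where
  "is_least_squares n K y m \<longleftrightarrow>
     is_arg_min (\<lambda>v. (scaled_norm n (\<lambda>i. y i - v i))\<^sup>2) (\<lambda>v. v \<in> K) m"

(* N(0, sigma^2 I): the second parameter of normal_density is the standard deviation. *)
definition isotropic_gaussian :: "nat \<Rightarrow> real \<Rightarrow> (nat \<Rightarrow> real) measure" where
  "isotropic_gaussian n \<sigma> =
     (\<Pi>\<^sub>M i\<in>{1..n}. density lborel (\<lambda>t. ennreal (normal_density 0 \<sigma> t)))"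

(* The bounds of the oracle inequalities; c is the constant in front of the variance term,
   1 in expectation and 2 in probability. *)
definition oracle_risk ::
  "real \<Rightarrow> nat \<Rightarrow> real \<Rightarrow> (nat \<Rightarrow> real) \<Rightarrow> (nat \<Rightarrow> real) \<Rightarrow> real" where
  "oracle_risk c n \<sigma> \<mu> u =
     (scaled_norm n (\<lambda>i. u i - \<mu> i))\<^sup>2
     + c * \<sigma>\<^sup>2 * real (num_pieces n u) / real n
         * ln (exp 1 * real n / real (num_pieces n u))"

end

theory Submission
  imports Defs
begin

text \<open>
  For a monotone \<open>u\<close> the error \<open>v = mu_hat y - u\<close> is nondecreasing on each constancy block of \<open>u\<close>,
  and the optimality of the projection gives
  \<open>|mu_hat y - \<mu>|\<^sup>2 - |u - \<mu>|\<^sup>2 \<le> 2 \<langle>\<xi>, v\<rangle> - |v|\<^sup>2\<close>.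
  On a block, the right-hand side is at most \<open>\<Sum> b t\<^sup>2\<close>, summed over the faces (length \<open>b\<close>, slope \<open>t\<close>)
  of the greatest convex minorant of the random walk with increments \<open>\<xi>\<close>. Everything follows
  from an exponential moment of this sum, computed as in Spitzer's combinatorial lemma: splitting
  off the first face, whose shape has conditional probability at most \<open>1 / b\<close> given its slope because
  at most one cyclic rotation of the increments is a face, yields for a block of length \<open>m\<close> the bound
  \<open>\<Prod>j<m. (s + j) / (j + 1) \<le> exp ((s - 1) (1 + ln m))\<close>, where \<open>s = (1 - 2 l \<sigma>\<^sup>2) powr (-1/2)\<close>
  is the moment \<open>E exp (l \<xi>\<^sub>1\<^sup>2)\<close>. The blocks are independent and \<open>\<Sum> (1 + ln m) \<le> k ln (e n / k)\<close> by
  concavity. Letting \<open>l\<close> tend to 0 gives the bound in expectation, and \<open>l = 1 / (4 \<sigma>\<^sup>2)\<close> the one in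
  probability, since \<open>sqrt 2 - 1 < 1 / 2\<close>.
\<close>

section \<open>The generating sequence of the exponential moments\<close>

definition normal_tail :: "real \<Rightarrow> real \<Rightarrow> real" where
  "normal_tail d c = 1 - cdf (density lborel (\<lambda>t. ennreal (normal_density 0 d t))) c"

lemma real_distribution_normal:
  "0 < d \<Longrightarrow> real_distribution (density lborel (\<lambda>t. ennreal (normal_density m d t)))"
  using prob_space_normal_density[of d m] by (simp add: real_distribution_def real_distribution_axioms_def)

lemma normal_tail_bounds:
  assumes "0 < d"
  shows "0 \<le> normal_tail d c" "normal_tail d c \<le> 1"
proof -
  interpret real_distribution "density lborel (\<lambda>t. ennreal (normal_density 0 d t))"
    by (rule real_distribution_normal[OF assms])
  show "0 \<le> normal_tail d c" "normal_tail d c \<le> 1"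
    by (auto simp: normal_tail_def cdf_bounded_prob cdf_nonneg)
qed

lemma normal_tail_tendsto_0:
  assumes "0 < d"
  shows "(normal_tail d \<longlongrightarrow> 0) at_top"
proof -
  interpret real_distribution "density lborel (\<lambda>t. ennreal (normal_density 0 d t))"
    by (rule real_distribution_normal[OF assms])
  show ?thesis
    unfolding normal_tail_def using tendsto_diff[OF tendsto_const cdf_lim_at_top_prob, of 1] by simp
qed

text \<open>By the fundamental theorem of calculus the distribution function has the same increments
  as an antiderivative \<open>F\<close> of the density, so the two differ by a constant.\<close>

lemma DERIV_normal_tail:
  assumes "0 < d"
  shows "(normal_tail d has_real_derivative - normal_density 0 d c) (at c)"
proof -
  let ?D = "density lborel (\<lambda>t. ennreal (normal_density 0 d t))"
  interpret real_distribution ?D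
    by (rule real_distribution_normal[OF assms])
  have cont: "isCont (normal_density 0 d) x" for x
    unfolding normal_density_def using assms by (auto intro!: continuous_intros)
  have "\<exists>F. \<forall>x::real. -\<infinity> < ereal x \<longrightarrow> ereal x < \<infinity> \<longrightarrow> (F has_vector_derivative normal_density 0 d x) (at x)"
    by (rule einterval_antiderivative) (simp, rule cont)
  then obtain F where "\<forall>x::real. -\<infinity> < ereal x \<longrightarrow> ereal x < \<infinity> \<longrightarrow> (F has_vector_derivative normal_density 0 d x) (at x)"
    by blast
  then have F: "(F has_real_derivative normal_density 0 d x) (at x)" for x
    by (simp add: has_real_derivative_iff_has_vector_derivative)
  have diff: "cdf ?D y - cdf ?D x = F y - F x" if "x \<le> y" for x y
  proof (cases "x < y")
    case True
    have "F x \<le> F y"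
      using that F normal_density_nonneg by (intro DERIV_nonneg_imp_nondecreasing[of x y F]) blast+
    have "emeasure ?D {x<..y} = (\<integral>\<^sup>+t. ennreal (normal_density 0 d t) * indicator {x<..y} t \<partial>lborel)"
      by (rule emeasure_density) auto
    \<comment> \<open>Increments of \<open>cdf\<close> measure half-open intervals; the added
      endpoint \<open>x\<close> is a null set.\<close>
    also have "\<dots> = (\<integral>\<^sup>+t. ennreal (normal_density 0 d t) * indicator {x..y} t \<partial>lborel)"
      using AE_lborel_singleton[of x] by (intro nn_integral_cong_AE) (auto split: split_indicator)
    also have "\<dots> = ennreal (F y - F x)"
      using that by (intro nn_integral_FTC_Icc F) simp_all
    finally have "measure ?D {x<..y} = F y - F x"
      using \<open>F x \<le> F y\<close> by (simp add: measure_def)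
    then show ?thesis
      using cdf_diff_eq[OF True] by simp
  qed (use that in auto)
  define C where "C = cdf ?D 0 - F 0"
  have "cdf ?D y = F y + C" for y
    using diff[of 0 y] diff[of y 0] unfolding C_def by (cases "0 \<le> y") auto
  then have "normal_tail d = (\<lambda>y. 1 - (F y + C))"
    by (auto simp: normal_tail_def)
  then show ?thesis
    by (auto intro!: derivative_eq_intros F)
qed

text \<open>
  Coefficient of \<open>z ^ m\<close> in \<open>exp (\<Sum>b\<ge>1. z ^ b * s / b * normal_tail (\<tau> / sqrt b) c)\<close>; at
  \<open>c = -\<infinity>\<close> the series is \<open>(1 - z) powr (-s)\<close>.
\<close>

fun spitzer :: "real \<Rightarrow> real \<Rightarrow> nat \<Rightarrow> real \<Rightarrow> real" where
  "spitzer s \<tau> 0 c = 1"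
| "spitzer s \<tau> (Suc m) c =
     s * (\<Sum>j\<le>m. normal_tail (\<tau> / sqrt (real (Suc m - j))) c * spitzer s \<tau> j c) / real (Suc m)"

text \<open>Comparison of the coefficients of \<open>z ^ m\<close> in
  \<open>z A' = (z S') A\<close>, where \<open>A = exp S\<close> is the generating series; the
  division-free form also covers \<open>m = 0\<close>.\<close>

lemma spitzer_rec:
  "real m * spitzer s \<tau> m c = (if m = 0 then 0 else
     s * (\<Sum>j<m. normal_tail (\<tau> / sqrt (real (m - j))) c * spitzer s \<tau> j c))"
  by (cases m) (auto simp: lessThan_Suc_atMost simp del: of_nat_Suc)

lemma spitzer_nonneg:
  assumes "0 < \<tau>" "0 \<le> s"
  shows "0 \<le> spitzer s \<tau> m c"
proof (induction m rule: less_induct)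
  case (less m)
  then show ?case
    using assms by (cases m) (auto intro!: divide_nonneg_nonneg mult_nonneg_nonneg sum_nonneg normal_tail_bounds(1))
qed

text \<open>As \<open>c\<close> tends to infinity the exponent of the generating series vanishes and
  the series becomes the constant 1. This supplies the boundary value for integrating the derivative
  over \<open>{c..}\<close>.\<close>

lemma spitzer_tendsto_0:
  assumes "0 < \<tau>"
  shows "(spitzer s \<tau> m \<longlongrightarrow> (if m = 0 then 1 else 0)) at_top"
proof (induction m rule: less_induct)
  case (less m)
  show ?case
  proof (cases m)
    case (Suc k)
    have "((\<lambda>c. s * (\<Sum>j\<le>k. normal_tail (\<tau> / sqrt (real (Suc k - j))) c * spitzer s \<tau> j c) / real (Suc k))
        \<longlongrightarrow> s * (\<Sum>j\<le>k. 0 * (if j = 0 then 1 else 0)) / real (Suc k)) at_top"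
      using assms Suc by (intro tendsto_intros normal_tail_tendsto_0 less.IH) auto
    then show ?thesis
      by (simp add: Suc)
  qed auto
qed

text \<open>Both sides are the triple convolution of \<open>f\<close>, \<open>g\<close> and
  \<open>a\<close>, with \<open>f\<close> and \<open>g\<close> evaluated at positive arguments only.
  After exchanging the sums, the reflection of \<open>j\<close> to \<open>m + i - j\<close>
  interchanges \<open>f\<close> and \<open>g\<close>.\<close>

lemma sum_triangle_reflect:
  fixes f g a :: "nat \<Rightarrow> real"
  shows "(\<Sum>j<m. f (m - j) * (\<Sum>i<j. g (j - i) * a i)) = (\<Sum>j<m. g (m - j) * (\<Sum>i<j. f (j - i) * a i))"
proof -
  have swap: "(\<Sum>j<m. f (m - j) * (\<Sum>i<j. g (j - i) * a i)) =
      (\<Sum>i<m. a i * (\<Sum>j\<in>{i<..<m}. f (m - j) * g (j - i)))" for f g :: "nat \<Rightarrow> real"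
  proof -
    have "(\<Sum>j<m. f (m - j) * (\<Sum>i<j. g (j - i) * a i)) =
        (\<Sum>j<m. \<Sum>i | i < m \<and> i < j. a i * (f (m - j) * g (j - i)))"
      unfolding sum_distrib_left by (intro sum.cong) (auto simp: mult_ac)
    also have "\<dots> = (\<Sum>i<m. \<Sum>j | j < m \<and> i < j. a i * (f (m - j) * g (j - i)))"
      using sum.swap_restrict[of "{..<m}" "{..<m}" "\<lambda>j i. a i * (f (m - j) * g (j - i))" "\<lambda>j i. i < j"] by simp
    finally show ?thesis
      unfolding sum_distrib_left by (auto intro!: sum.cong)
  qed
  have "(\<Sum>j\<in>{i<..<m}. f (m - j) * g (j - i)) = (\<Sum>j\<in>{i<..<m}. g (m - j) * f (j - i))" for i
    by (rule sum.reindex_bij_witness[of _ "\<lambda>j. m + i - j" "\<lambda>j. m + i - j"]) auto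
  then show ?thesis
    by (simp add: swap)
qed

text \<open>Coefficient form of \<open>(exp S)' = S' exp S\<close>, differentiated in
  \<open>c\<close>. The induction differentiates the recursion and regroups the two
  convolutions.\<close>

lemma DERIV_spitzer:
  assumes "0 < \<tau>"
  shows "(spitzer s \<tau> m has_real_derivative
     - (\<Sum>j<m. s / real (m - j) * normal_density 0 (\<tau> / sqrt (real (m - j))) c * spitzer s \<tau> j c)) (at c)"
proof (induction m rule: less_induct)
  case (less m)
  define T where "T = (\<lambda>b. s * normal_tail (\<tau> / sqrt (real b)) c)"
  define h where "h = (\<lambda>b. s / real b * normal_density 0 (\<tau> / sqrt (real b)) c)"
  define a where "a = (\<lambda>j. spitzer s \<tau> j c)"
  show ?case
  proof (cases "m = 0")
    case False
    have "((\<lambda>c. s * (\<Sum>j<m. normal_tail (\<tau> / sqrt (real (m - j))) c * spitzer s \<tau> j c) / real m)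
      has_real_derivative s * (\<Sum>j<m. - normal_density 0 (\<tau> / sqrt (real (m - j))) c * a j
          + - (\<Sum>i<j. h (j - i) * a i) * normal_tail (\<tau> / sqrt (real (m - j))) c) / real m) (at c)"
      unfolding a_def h_def using assms
      by (intro DERIV_cdivide DERIV_cmult DERIV_sum DERIV_mult DERIV_normal_tail less.IH) auto
    also have "(\<lambda>c. s * (\<Sum>j<m. normal_tail (\<tau> / sqrt (real (m - j))) c * spitzer s \<tau> j c) / real m) = spitzer s \<tau> m"
    proof
      fix c
      show "s * (\<Sum>j<m. normal_tail (\<tau> / sqrt (real (m - j))) c * spitzer s \<tau> j c) / real m = spitzer s \<tau> m c"
        using spitzer_rec[of m s \<tau> c] False
        by (metis nonzero_mult_div_cancel_left of_nat_eq_0_iff)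
    qed
    also have "s * (\<Sum>j<m. - normal_density 0 (\<tau> / sqrt (real (m - j))) c * a j
          + - (\<Sum>i<j. h (j - i) * a i) * normal_tail (\<tau> / sqrt (real (m - j))) c)
        = (\<Sum>j<m. - (real (m - j) * h (m - j) * a j) - T (m - j) * (\<Sum>i<j. h (j - i) * a i))"
      unfolding sum_distrib_left[of s]
    proof (rule sum.cong[OF refl])
      fix j assume "j \<in> {..<m}"
      then have "real (m - j) * h (m - j) = s * normal_density 0 (\<tau> / sqrt (real (m - j))) c"
        by (simp add: h_def)
      then show "s * (- normal_density 0 (\<tau> / sqrt (real (m - j))) c * a j
          + - (\<Sum>i<j. h (j - i) * a i) * normal_tail (\<tau> / sqrt (real (m - j))) c)
          = - (real (m - j) * h (m - j) * a j) - T (m - j) * (\<Sum>i<j. h (j - i) * a i)"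
        unfolding T_def by algebra
    qed
    also have "\<dots> = - (\<Sum>j<m. real (m - j) * h (m - j) * a j) - (\<Sum>j<m. T (m - j) * (\<Sum>i<j. h (j - i) * a i))"
      by (simp only: sum_subtractf sum_negf)
    \<comment> \<open>Reflection brings \<open>T\<close> next to \<open>a\<close>, so that the inner
      sum is the recursion for \<open>real j * a j\<close>.\<close>
    also have "(\<Sum>j<m. T (m - j) * (\<Sum>i<j. h (j - i) * a i)) = (\<Sum>j<m. h (m - j) * (\<Sum>i<j. T (j - i) * a i))"
      by (rule sum_triangle_reflect)
    also have "\<dots> = (\<Sum>j<m. h (m - j) * (real j * a j))"
    proof (rule sum.cong[OF refl])
      fix j
      show "h (m - j) * (\<Sum>i<j. T (j - i) * a i) = h (m - j) * (real j * a j)"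
        unfolding a_def T_def spitzer_rec by (simp add: sum_distrib_left mult.assoc)
    qed
    \<comment> \<open>The weights \<open>m - j\<close> and \<open>j\<close> add up to
      \<open>m\<close>, which cancels the denominator of the recursion.\<close>
    also have "- (\<Sum>j<m. real (m - j) * h (m - j) * a j) - \<dots> = - (real m * (\<Sum>j<m. h (m - j) * a j))"
      unfolding sum_distrib_left sum_negf[symmetric] sum_subtractf[symmetric]
    proof (rule sum.cong[OF refl])
      fix j assume "j \<in> {..<m}"
      then have *: "real (m - j) + real j = real m"
        by (simp add: of_nat_diff)
      have "- (real (m - j) * h (m - j) * a j) - h (m - j) * (real j * a j)
          = - ((real (m - j) + real j) * (h (m - j) * a j))"
        by algebra
      then show "- (real (m - j) * h (m - j) * a j) - h (m - j) * (real j * a j) = - (real m * (h (m - j) * a j))"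
        by (simp only: *)
    qed
    also have "- (real m * (\<Sum>j<m. h (m - j) * a j)) / real m = - (\<Sum>j<m. h (m - j) * a j)"
      using False by simp
    finally show ?thesis
      by (simp only: h_def a_def)
  next
    case True
    then have "spitzer s \<tau> m = (\<lambda>c. 1)"
      by auto
    then show ?thesis
      using True by simp
  qed
qed

lemma continuous_spitzer:
  assumes "0 < \<tau>"
  shows "isCont (spitzer s \<tau> m) c"
  using DERIV_spitzer[OF assms] by (rule DERIV_isCont)

lemma borel_measurable_spitzer:
  assumes "0 < \<tau>"
  shows "spitzer s \<tau> m \<in> borel_measurable borel"
  using continuous_spitzer[OF assms] by (intro borel_measurable_continuous_onI) (simp add: continuous_at_imp_continuous_on)

text \<open>The derivative is integrated from \<open>c\<close> to infinity, where the limit is 0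
  because \<open>m > 0\<close>. In the application \<open>t\<close> is the slope of the first face,
  \<open>m - j\<close> its length and \<open>j\<close> the length that remains, so the identity
  closes the induction over block lengths.\<close>

lemma nn_integral_spitzer:
  assumes "0 < \<tau>" "0 \<le> s" "0 < m"
  shows "(\<Sum>j<m. \<integral>\<^sup>+t. ennreal (s / real (m - j) * normal_density 0 (\<tau> / sqrt (real (m - j))) t
             * spitzer s \<tau> j t) * indicator {c..} t \<partial>lborel) = ennreal (spitzer s \<tau> m c)"
proof -
  note [measurable] = borel_measurable_spitzer[OF assms(1)]
  let ?f = "\<lambda>j t. s / real (m - j) * normal_density 0 (\<tau> / sqrt (real (m - j))) t * spitzer s \<tau> j t"
  have nn: "0 \<le> ?f j t" for j t
    using assms by (intro mult_nonneg_nonneg spitzer_nonneg normal_density_nonneg divide_nonneg_nonneg) auto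
  have "(\<Sum>j<m. \<integral>\<^sup>+t. ennreal (?f j t) * indicator {c..} t \<partial>lborel)
      = (\<integral>\<^sup>+t. ennreal (\<Sum>j<m. ?f j t) * indicator {c..} t \<partial>lborel)"
    unfolding sum_ennreal[OF nn, symmetric] sum_distrib_right by (rule nn_integral_sum[symmetric]) measurable
  also have "\<dots> = ennreal (0 - (- spitzer s \<tau> m c))"
  proof (rule nn_integral_FTC_atLeast)
    show "((\<lambda>x. - spitzer s \<tau> m x) \<longlongrightarrow> 0) at_top"
      using tendsto_minus[OF spitzer_tendsto_0[OF assms(1), of s m]] assms(3) by simp
    show "((\<lambda>x. - spitzer s \<tau> m x) has_real_derivative (\<Sum>j<m. ?f j x)) (at x)" for x
      using DERIV_minus[OF DERIV_spitzer[OF assms(1), of s m x]] by simp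
    show "0 \<le> (\<Sum>j<m. ?f j x)" for x
      by (rule sum_nonneg) (rule nn)
  qed measurable
  finally show ?thesis by simp
qed

text \<open>With every tail bounded by 1 the recursion becomes
  \<open>m * P m = s * (\<Sum>j<m. P j)\<close>, which the coefficients of
  \<open>(1 - z) powr (-s)\<close> solve exactly.\<close>

lemma spitzer_le_prod:
  assumes "0 < \<tau>" "0 \<le> s"
  shows "spitzer s \<tau> m c \<le> (\<Prod>j<m. (s + real j) / real (Suc j))"
proof -
  let ?P = "\<lambda>m. \<Prod>j<m. (s + real j) / real (Suc j)"
  have rec: "real m * ?P m = s * (\<Sum>j<m. ?P j)" for m
  proof (induction m)
    case (Suc m)
    have "real (Suc m) * ?P (Suc m) = s * ?P m + real m * ?P m"
      by (simp add: field_simps)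
    with Suc show ?case by (simp add: algebra_simps)
  qed simp
  show ?thesis
  proof (induction m rule: less_induct)
    case (less m)
    show ?case
    proof (cases "m = 0")
      case False
      have "(\<Sum>j<m. normal_tail (\<tau> / sqrt (real (m - j))) c * spitzer s \<tau> j c) \<le> (\<Sum>j<m. 1 * ?P j)"
        using assms by (intro sum_mono mult_mono less.IH normal_tail_bounds spitzer_nonneg) auto
      then have "real m * spitzer s \<tau> m c \<le> s * (\<Sum>j<m. 1 * ?P j)"
        using False assms unfolding spitzer_rec by (simp add: mult_left_mono)
      also have "\<dots> = real m * ?P m"
        unfolding mult_1_left by (rule rec[symmetric])
      finally show ?thesis using False by simp
    qed simp
  qed
qed

text \<open>Each factor is \<open>1 + (s - 1) / (j + 1)\<close>, at most an exponential, and the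
  harmonic sum is at most \<open>1 + ln m\<close>.\<close>

lemma prod_le_exp_ln:
  assumes "1 \<le> s" "0 < m"
  shows "(\<Prod>j<m. (s + real j) / real (Suc j)) \<le> exp ((s - 1) * (1 + ln (real m)))"
  using assms(2)
proof (induction m rule: nat_induct_non_zero)
  case 1
  then show ?case using exp_ge_add_one_self[of "s - 1"] by simp
next
  case (Suc m)
  \<comment> \<open>\<open>ln y \<le> y - 1\<close> at \<open>y = m / (m + 1)\<close> bounds one
    harmonic term by a difference of logarithms.\<close>
  have "ln (real m / real (Suc m)) \<le> real m / real (Suc m) - 1"
    using Suc by (intro ln_le_minus_one) auto
  then have *: "1 / real (Suc m) \<le> ln (real (Suc m)) - ln (real m)"
    using Suc by (simp add: ln_div field_simps)
  have "(s + real m) / real (Suc m) = 1 + (s - 1) / real (Suc m)"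
    by (simp add: field_simps)
  also have "\<dots> \<le> exp ((s - 1) / real (Suc m))"
    by (rule exp_ge_add_one_self)
  also have "\<dots> \<le> exp ((s - 1) * (ln (real (Suc m)) - ln (real m)))"
    using mult_left_mono[OF *, of "s - 1"] assms by simp
  finally have "(\<Prod>j<Suc m. (s + real j) / real (Suc j)) \<le>
      exp ((s - 1) * (1 + ln (real m))) * exp ((s - 1) * (ln (real (Suc m)) - ln (real m)))"
    unfolding prod.lessThan_Suc using Suc assms
    by (intro mult_mono) (auto intro!: prod_nonneg)
  then show ?case
    by (simp add: exp_add[symmetric] algebra_simps)
qed

section \<open>Faces of the convex minorant and the cycle lemma\<close>

text \<open>Slope of the chord, between times \<open>p\<close> and \<open>r\<close>, of the walk
  with increments \<open>x\<close>.\<close>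

definition avg :: "nat \<Rightarrow> nat \<Rightarrow> (nat \<Rightarrow> real) \<Rightarrow> real" where
  "avg p r x = (\<Sum>i\<in>{p<..r}. x i) / real (r - p)"

text \<open>
  The walk with increments \<open>x\<close> stays strictly above its chord between \<open>p\<close> and \<open>r\<close>. Strictness makes
  at most one cyclic rotation of the increments a face.
\<close>

definition face :: "nat \<Rightarrow> nat \<Rightarrow> (nat \<Rightarrow> real) \<Rightarrow> bool" where
  "face p r x \<longleftrightarrow> (\<forall>k\<in>{p<..<r}. avg p r x < avg p k x)"

definition rot :: "nat \<Rightarrow> nat \<Rightarrow> nat \<Rightarrow> nat \<Rightarrow> nat" where
  "rot p r j i = Suc p + (i - Suc p + j) mod (r - p)"

lemma avg_cong: "(\<And>i. i \<in> {p<..r} \<Longrightarrow> x i = y i) \<Longrightarrow> avg p r x = avg p r y"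
  unfolding avg_def by (metis (no_types, lifting) sum.cong)

lemma face_cong: "(\<And>i. i \<in> {p<..r} \<Longrightarrow> x i = y i) \<Longrightarrow> face p r x = face p r y"
  unfolding face_def using avg_cong[of p _ x y] by (auto intro!: ball_cong)

lemma avg_mult: "p < r \<Longrightarrow> real (r - p) * avg p r x = (\<Sum>i\<in>{p<..r}. x i)"
  by (simp add: avg_def)

lemma borel_measurable_avg [measurable]:
  assumes "{p<..r} \<subseteq> I"
  shows "avg p r \<in> borel_measurable (Pi\<^sub>M I (\<lambda>_. borel))"
  unfolding avg_def using assms
  by (intro borel_measurable_divide borel_measurable_sum measurable_component_singleton) auto

lemma measurable_face [measurable]:
  assumes "{p<..r} \<subseteq> I"
  shows "Measurable.pred (Pi\<^sub>M I (\<lambda>_. borel)) (face p r)"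
proof -
  have [measurable]: "avg p k \<in> borel_measurable (Pi\<^sub>M I (\<lambda>_. borel))" if "k \<le> r" for k
    using that assms by (intro borel_measurable_avg) auto
  show ?thesis
    unfolding face_def by (intro pred_intros_finite) measurable
qed

lemma rot_bij: "p < r \<Longrightarrow> bij_betw (rot p r j) {p<..r} {p<..r}"
proof -
  assume "p < r"
  have "inj_on (rot p r j) {p<..r}"
  proof (rule inj_onI)
    fix a b assume *: "a \<in> {p<..r}" "b \<in> {p<..r}" "rot p r j a = rot p r j b"
    then have eq: "(a - Suc p + j) mod (r - p) = (b - Suc p + j) mod (r - p)"
      by (simp add: rot_def)
    \<comment> \<open>Natural subtraction turns one of the two differences into 0, so both
      divisibilities hold in either order of \<open>a\<close> and \<open>b\<close>.\<close>
    have "r - p dvd a - b" "r - p dvd b - a"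
      using eq mod_eq_dvd_iff_nat[of "b - Suc p + j" "a - Suc p + j" "r - p"]
        mod_eq_dvd_iff_nat[of "a - Suc p + j" "b - Suc p + j" "r - p"] *
      by (cases "a \<le> b"; simp)+
    then show "a = b"
      using * nat_dvd_not_less[of "a - b" "r - p"] nat_dvd_not_less[of "b - a" "r - p"] by fastforce
  qed
  moreover have "rot p r j ` {p<..r} \<subseteq> {p<..r}"
  proof
    fix y assume "y \<in> rot p r j ` {p<..r}"
    then obtain i where "y = Suc p + (i - Suc p + j) mod (r - p)"
      unfolding rot_def by blast
    moreover have "(i - Suc p + j) mod (r - p) < r - p"
      using \<open>p < r\<close> by simp
    ultimately show "y \<in> {p<..r}"
      by simp
  qed
  ultimately show ?thesis
    by (simp add: bij_betw_def endo_inj_surj)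
qed

lemma avg_rot: "p < r \<Longrightarrow> avg p r (\<lambda>i. x (rot p r j i)) = avg p r x"
  unfolding avg_def using sum.reindex_bij_betw[OF rot_bij, of p r x j] by simp

text \<open>Cycle lemma. Subtracting the mean makes the walk \<open>W\<close> periodic with period
  \<open>b\<close>; the rotation by \<open>j\<close> can be a face only if \<open>W\<close> takes at
  \<open>j\<close> its strict minimum over a period, and such a \<open>j\<close> is unique.\<close>

lemma face_rot_unique:
  assumes "p < r"
  shows "card {j. j < r - p \<and> face p r (\<lambda>i. x (rot p r j i))} \<le> 1"
proof -
  define b where "b = r - p"
  define t where "t = avg p r x"
  define e where "e = (\<lambda>k. x (Suc p + k mod b) - t)"
  define W where "W = (\<lambda>k. \<Sum>i<k. e i)"
  have b: "0 < b" "r = p + b"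
    using assms by (auto simp: b_def)
  have shift: "(\<Sum>i\<in>{p<..p + k}. f i) = (\<Sum>i<k. f (Suc p + i))" for f :: "nat \<Rightarrow> real" and k
    by (rule sum.reindex_bij_witness[of _ "\<lambda>i. Suc p + i" "\<lambda>i. i - Suc p"]) auto
  have Wadd: "W (j + k) - W j = (\<Sum>i<k. e (i + j))" for j k
    by (induction k) (auto simp: W_def add.commute)
  have "W b = (\<Sum>i<b. x (Suc p + i) - t)"
    unfolding W_def e_def by (rule sum.cong) auto
  also have "\<dots> = (\<Sum>i\<in>{p<..r}. x i) - real b * t"
    by (simp add: sum_subtractf shift b(2))
  also have "\<dots> = 0"
    using b by (simp add: t_def avg_def)
  finally have "W b = 0" .
  moreover have "W (j + b) - W b = W j" for j
    using Wadd[of b j] by (simp add: add.commute W_def e_def)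
  ultimately have per: "W (j + b) = W j" for j
    by simp
  have pos: "W j < W (j + k)" if "face p r (\<lambda>i. x (rot p r j i))" "0 < k" "k < b" for j k
  proof -
    have "t < avg p (p + k) (\<lambda>i. x (rot p r j i))"
      using that b avg_rot[OF assms, of x j] by (auto simp: face_def t_def)
    then have "real k * t < (\<Sum>i\<in>{p<..p + k}. x (rot p r j i))"
      using that by (simp add: avg_def field_simps)
    also have "\<dots> = (\<Sum>i<k. e (i + j)) + real k * t"
      by (simp add: shift rot_def e_def b_def sum_subtractf)
    finally show ?thesis
      using Wadd[of j k] by simp
  qed
  have less: False if "face p r (\<lambda>i. x (rot p r j i))" "face p r (\<lambda>i. x (rot p r j' i))" "j < j'" "j' < b" for j j'
  proof -
    have "W j < W j'"
      using pos[OF that(1), of "j' - j"] that by auto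
    \<comment> \<open>From \<open>j'\<close> the position \<open>j\<close> of the next period is
      \<open>b + j - j'\<close> steps away.\<close>
    moreover have "W j' < W (j + b)"
      using pos[OF that(2), of "b + j - j'"] that by (auto simp: add.commute)
    ultimately show False
      by (simp add: per)
  qed
  show ?thesis
    unfolding b_def[symmetric] using less
    by (intro card_le_Suc0_iff_eq[THEN iffD2, unfolded One_nat_def[symmetric]] ballI) (auto, metis linorder_neqE_nat)
qed

text \<open>The product law and the mean are invariant under rotation, so the \<open>r - p\<close>
  rotations contribute equal integrals, and pointwise their face indicators sum to at most
  1.\<close>

lemma nn_integral_face_le:
  fixes f :: "real \<Rightarrow> ennreal"
  assumes "prob_space N" and sets_N: "sets N = sets borel" and "p < r" and [measurable]: "f \<in> borel_measurable borel"
  shows "ennreal (real (r - p)) * (\<integral>\<^sup>+x. indicator {x. face p r x} x * f (avg p r x) \<partial>Pi\<^sub>M {p<..r} (\<lambda>_. N))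
    \<le> (\<integral>\<^sup>+x. f (avg p r x) \<partial>Pi\<^sub>M {p<..r} (\<lambda>_. N))"
proof -
  let ?P = "Pi\<^sub>M {p<..r} (\<lambda>_. N)"
  let ?g = "\<lambda>x. indicator {x. face p r x} x * f (avg p r x)"
  let ?\<rho> = "\<lambda>j x. \<lambda>i\<in>{p<..r}. x (rot p r j i)"
  have sP: "sets ?P = sets (Pi\<^sub>M {p<..r} (\<lambda>_. borel))"
    by (intro sets_PiM_cong refl sets_N)
  have [measurable]: "face p r \<in> measurable ?P (count_space UNIV)"
    using measurable_face[OF subset_refl] measurable_cong_sets[OF sP refl] by blast
  have [measurable]: "avg p r \<in> borel_measurable ?P"
    using borel_measurable_avg[OF subset_refl] measurable_cong_sets[OF sP refl] by blast
  have mg [measurable]: "?g \<in> borel_measurable ?P"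
    by measurable
  have inv: "distr ?P ?P (?\<rho> j) = ?P" for j
    using distr_PiM_reindex[of "{p<..r}" "\<lambda>_. N" "rot p r j" "{p<..r}"] assms(1) rot_bij[OF assms(3), of j]
    by (auto simp: bij_betw_def)
  have m\<rho> [measurable]: "?\<rho> j \<in> measurable ?P ?P" for j
    using rot_bij[OF assms(3), of j] by (intro measurable_restrict measurable_component_singleton) (auto simp: bij_betw_def)
  have "(\<integral>\<^sup>+x. ?g x \<partial>?P) = (\<integral>\<^sup>+x. ?g (?\<rho> j x) \<partial>?P)" for j
    by (subst inv[of j, symmetric], rule nn_integral_distr) measurable
  also have "\<dots> j = (\<integral>\<^sup>+x. indicator {x. face p r (\<lambda>i. x (rot p r j i))} x * f (avg p r x) \<partial>?P)" for j
  proof (rule nn_integral_cong)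
    fix x
    have "face p r (?\<rho> j x) = face p r (\<lambda>i. x (rot p r j i))"
      by (rule face_cong) auto
    moreover have "avg p r (?\<rho> j x) = avg p r (\<lambda>i. x (rot p r j i))"
      by (rule avg_cong) auto
    ultimately show "?g (?\<rho> j x) = indicator {x. face p r (\<lambda>i. x (rot p r j i))} x * f (avg p r x)"
      using avg_rot[OF assms(3)] by (simp add: indicator_def)
  qed
  finally have "ennreal (real (r - p)) * (\<integral>\<^sup>+x. ?g x \<partial>?P)
      = (\<Sum>j<r - p. \<integral>\<^sup>+x. indicator {x. face p r (\<lambda>i. x (rot p r j i))} x * f (avg p r x) \<partial>?P)"
    by (simp add: ennreal_of_nat_eq_real_of_nat)
  also have "\<dots> = (\<integral>\<^sup>+x. (\<Sum>j<r - p. indicator {x. face p r (\<lambda>i. x (rot p r j i))} x * f (avg p r x)) \<partial>?P)"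
  proof (rule nn_integral_sum[symmetric])
    fix j
    have "(\<lambda>x. face p r (?\<rho> j x)) \<in> measurable ?P (count_space UNIV)"
      by measurable
    also have "(\<lambda>x. face p r (?\<rho> j x)) = (\<lambda>x. face p r (\<lambda>i. x (rot p r j i)))"
      by (intro ext face_cong) auto
    finally have [measurable]: "(\<lambda>x. face p r (\<lambda>i. x (rot p r j i))) \<in> measurable ?P (count_space UNIV)" .
    show "(\<lambda>x. indicator {x. face p r (\<lambda>i. x (rot p r j i))} x * f (avg p r x)) \<in> borel_measurable ?P"
      by measurable
  qed
  also have "\<dots> \<le> (\<integral>\<^sup>+x. f (avg p r x) \<partial>?P)"
  proof (rule nn_integral_mono)
    fix x
    have "(\<Sum>j<r - p. indicator {x. face p r (\<lambda>i. x (rot p r j i))} x :: ennreal)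
        = of_nat (card {j. j < r - p \<and> face p r (\<lambda>i. x (rot p r j i))})"
      by (simp add: indicator_def sum.If_cases Int_def lessThan_def)
    also have "\<dots> \<le> 1"
      using face_rot_unique[OF assms(3), of x] by (metis of_nat_1 of_nat_mono)
    finally show "(\<Sum>j<r - p. indicator {x. face p r (\<lambda>i. x (rot p r j i))} x * f (avg p r x)) \<le> f (avg p r x)"
      unfolding sum_distrib_right[symmetric] using mult_right_mono by fastforce
  qed
  finally show ?thesis .
qed

section \<open>Law of the mean over a block and its exponential tilting\<close>

lemma distributed_avg:
  assumes "0 < \<sigma>" "p < r"
  defines "N \<equiv> density lborel (\<lambda>t. ennreal (normal_density 0 \<sigma> t))"
  shows "distributed (Pi\<^sub>M {p<..r} (\<lambda>_. N)) lborel (avg p r) (normal_density 0 (\<sigma> / sqrt (real (r - p))))"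
proof -
  let ?P = "Pi\<^sub>M {p<..r} (\<lambda>_. N)"
  have N: "prob_space N"
    unfolding N_def by (rule prob_space_normal_density) fact
  interpret product_prob_space "\<lambda>_. N" "{p<..r}"
    using N by (simp add: product_prob_space_def product_prob_space_axioms_def product_sigma_finite_def prob_space_imp_sigma_finite)
  interpret P: prob_space ?P
    by (rule prob_space_PiM) (rule N)
  have sets_N: "sets N = sets borel"
    by (simp add: N_def)
  have rv: "(\<lambda>x. x i) \<in> measurable ?P borel" if "i \<in> {p<..r}" for i
    using measurable_component_singleton[OF that, of "\<lambda>_. N"] measurable_cong_sets[OF refl sets_N] by blast
  have comp: "distr ?P borel (\<lambda>x. x i) = N" if "i \<in> {p<..r}" for i
    using PiM_component[OF that] distr_cong[OF refl sets_N, of ?P "\<lambda>x. x i"] by simp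
  \<comment> \<open>Independence is checked as equality of the joint law with the product of the
    marginals; the joint map is the identity on the space.\<close>
  have ind: "P.indep_vars (\<lambda>_. borel) (\<lambda>i x. x i) {p<..r}"
  proof (subst P.indep_vars_iff_distr_eq_PiM')
    have "distr ?P (Pi\<^sub>M {p<..r} (\<lambda>_. borel)) (\<lambda>x. \<lambda>i\<in>{p<..r}. x i) = distr ?P ?P (\<lambda>x. x)"
      by (rule distr_cong) (auto simp: space_PiM intro!: sets_PiM_cong sets_N[symmetric])
    also have "\<dots> = Pi\<^sub>M {p<..r} (\<lambda>i. distr ?P borel (\<lambda>x. x i))"
      by (subst distr_id) (auto intro!: PiM_cong simp: comp)
    finally show "distr ?P (Pi\<^sub>M {p<..r} (\<lambda>_. borel)) (\<lambda>x. \<lambda>i\<in>{p<..r}. x i) =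
        Pi\<^sub>M {p<..r} (\<lambda>i. distr ?P borel (\<lambda>x. x i))" .
  qed (use \<open>p < r\<close> rv in auto)
  have "distributed ?P lborel (\<lambda>x. \<Sum>i\<in>{p<..r}. x i)
     (normal_density (\<Sum>i\<in>{p<..r}. 0) (sqrt (\<Sum>i\<in>{p<..r}. \<sigma>\<^sup>2)))"
  proof (rule P.sum_indep_normal[OF _ _ ind])
    fix i assume "i \<in> {p<..r}"
    then show "distributed ?P lborel (\<lambda>x. x i) (normal_density 0 \<sigma>)"
      using comp rv by (auto simp: distributed_def N_def cong: distr_cong)
  qed (use assms in auto)
  then have "distributed ?P lborel (\<lambda>x. \<Sum>i\<in>{p<..r}. x i) (normal_density 0 (sqrt (real (r - p)) * \<sigma>))"
    using assms by (simp add: real_sqrt_mult)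
  from P.normal_density_affine[OF this, of "1 / real (r - p)" 0]
  have "distributed ?P lborel (\<lambda>x. (\<Sum>i\<in>{p<..r}. x i) / real (r - p))
     (normal_density 0 (sqrt (real (r - p)) * \<sigma> / real (r - p)))"
    using assms by simp
  also have "sqrt (real (r - p)) * \<sigma> / real (r - p) = \<sigma> / sqrt (real (r - p))"
    using assms by (simp add: real_div_sqrt field_simps flip: real_sqrt_mult)
  finally show ?thesis
    unfolding avg_def[abs_def] .
qed

text \<open>Completing the square: the tilt divides the variance by
  \<open>1 - 2 l \<sigma>^2\<close> and multiplies the mass by \<open>s\<close>. Neither factor
  depends on \<open>b\<close>, so one \<open>s\<close> and one scale
  \<open>\<tau> = \<sigma> * s\<close> serve all face lengths.\<close>

lemma tilted_normal_density:
  assumes "0 < \<sigma>" "0 < b" "2 * l * \<sigma>\<^sup>2 < 1"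
  shows "exp (l * b * t\<^sup>2) * normal_density 0 (\<sigma> / sqrt b) t =
     1 / sqrt (1 - 2 * l * \<sigma>\<^sup>2) * normal_density 0 (\<sigma> / sqrt (1 - 2 * l * \<sigma>\<^sup>2) / sqrt b) t"
proof -
  define q where "q = 1 - 2 * l * \<sigma>\<^sup>2"
  have q: "0 < q" "l = (1 - q) / (2 * \<sigma>\<^sup>2)"
    using assms by (auto simp: q_def field_simps)
  have "l * b * t\<^sup>2 + (- t\<^sup>2 / (2 * (\<sigma> / sqrt b)\<^sup>2)) = - t\<^sup>2 / (2 * (\<sigma> / sqrt q / sqrt b)\<^sup>2)"
  proof -
    have "(\<sigma> / sqrt b)\<^sup>2 = \<sigma>\<^sup>2 / b" "(\<sigma> / sqrt q / sqrt b)\<^sup>2 = \<sigma>\<^sup>2 / (q * b)"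
      using assms q by (auto simp: power_divide power_mult_distrib)
    then show ?thesis
      unfolding q(2) using assms q by (simp add: field_simps)
  qed
  moreover have "1 / sqrt (2 * pi * (\<sigma> / sqrt b)\<^sup>2) = 1 / sqrt q * (1 / sqrt (2 * pi * (\<sigma> / sqrt q / sqrt b)\<^sup>2))"
    using assms q by (simp add: field_simps power_divide real_sqrt_mult real_sqrt_divide)
  ultimately show ?thesis
    unfolding q_def[symmetric] normal_density_def by (simp add: exp_add[symmetric] mult_ac)
qed

section \<open>Exponential moment on one block\<close>

lemma sum_greaterThanAtMost_split:
  fixes f :: "nat \<Rightarrow> real"
  assumes "p \<le> r" "r \<le> q"
  shows "(\<Sum>i\<in>{p<..q}. f i) = (\<Sum>i\<in>{p<..r}. f i) + (\<Sum>i\<in>{r<..q}. f i)"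
proof -
  have "{p<..q} = {p<..r} \<union> {r<..q}"
    using assms by auto
  then show ?thesis
    by (simp add: sum.union_disjoint)
qed

text \<open>Summation by parts: the partial sums of \<open>d\<close> are nonnegative, so passing
  from \<open>v k\<close> to the larger \<open>v (Suc k)\<close> can only increase the bound
  \<open>(\<Sum>i\<in>{p<..k}. d i) * v k\<close>, and at \<open>k = r\<close> this bound is
  0.\<close>

lemma sum_mult_mono_nonpos:
  fixes d v :: "nat \<Rightarrow> real"
  assumes D: "\<And>k. k \<in> {p<..<r} \<Longrightarrow> 0 \<le> (\<Sum>i\<in>{p<..k}. d i)" and "(\<Sum>i\<in>{p<..r}. d i) = 0"
    and v: "\<And>i. i \<in> {p<..<r} \<Longrightarrow> v i \<le> v (Suc i)" and "p < r"
  shows "(\<Sum>i\<in>{p<..r}. d i * v i) \<le> 0"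
proof -
  have "(\<Sum>i\<in>{p<..k}. d i * v i) \<le> (\<Sum>i\<in>{p<..k}. d i) * v k" if "Suc p \<le> k" "k \<le> r" for k
    using that
  proof (induction k rule: dec_induct)
    case base
    have "{p<..Suc p} = {Suc p}" by auto
    then show ?case by simp
  next
    case (step k)
    have ins: "{p<..Suc k} = insert (Suc k) {p<..k}"
      using step by auto
    have "(\<Sum>i\<in>{p<..k}. d i) * v k \<le> (\<Sum>i\<in>{p<..k}. d i) * v (Suc k)"
      using step by (intro mult_left_mono v D) auto
    then show ?case
      using step by (simp add: ins algebra_simps)
  qed
  from this[of r] show ?thesis
    using assms by simp
qed

text \<open>On a face the centred increments have nonnegative partial sums, so against a
  nondecreasing \<open>v\<close> the increments may be replaced by their mean \<open>t\<close>; then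
  \<open>2 t v - v^2 \<le> t^2\<close>.\<close>

lemma face_bound:
  assumes "face p r x" "p < r" and v: "\<And>i. i \<in> {p<..<r} \<Longrightarrow> v i \<le> v (Suc i)"
  shows "(\<Sum>i\<in>{p<..r}. 2 * x i * v i - (v i)\<^sup>2) \<le> real (r - p) * (avg p r x)\<^sup>2"
proof -
  define t where "t = avg p r x"
  have neg: "(\<Sum>i\<in>{p<..r}. (x i - t) * v i) \<le> 0"
  proof (rule sum_mult_mono_nonpos)
    fix k assume k: "k \<in> {p<..<r}"
    then have "real (k - p) * t \<le> real (k - p) * avg p k x"
      using assms by (intro mult_left_mono) (auto simp: face_def t_def intro: less_imp_le)
    then show "0 \<le> (\<Sum>i\<in>{p<..k}. x i - t)"
      using avg_mult[of p k x] k by (simp add: sum_subtractf)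
  next
    show "(\<Sum>i\<in>{p<..r}. x i - t) = 0"
      using avg_mult[of p r x] assms by (simp add: sum_subtractf t_def)
  qed (use assms v in auto)
  have "2 * x i * v i - (v i)\<^sup>2 \<le> 2 * ((x i - t) * v i) + t\<^sup>2" for i
    using zero_le_power2[of "v i - t"] by (simp add: power2_eq_square algebra_simps)
  then have "(\<Sum>i\<in>{p<..r}. 2 * x i * v i - (v i)\<^sup>2) \<le> (\<Sum>i\<in>{p<..r}. 2 * ((x i - t) * v i) + t\<^sup>2)"
    by (intro sum_mono)
  also have "\<dots> = 2 * (\<Sum>i\<in>{p<..r}. (x i - t) * v i) + real (r - p) * t\<^sup>2"
    by (simp add: sum.distrib sum_distrib_left)
  finally show ?thesis
    using neg by (simp add: t_def)
qed

text \<open>Among the prefixes of minimal mean the shortest is taken: minimality gives the last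
  clause, and the shortest choice gives the strict inequalities of \<open>face\<close>.\<close>

lemma first_face_exists:
  assumes "p < q"
  obtains r where "r \<in> {p<..q}" "face p r x" "\<And>k. k \<in> {p<..q} \<Longrightarrow> avg p r x \<le> avg p k x"
proof -
  let ?R = "{r \<in> {p<..q}. \<forall>k\<in>{p<..q}. avg p r x \<le> avg p k x}"
  obtain r0 where "is_arg_min (\<lambda>r. avg p r x) (\<lambda>r. r \<in> {p<..q}) r0"
    using ex_is_arg_min_if_finite[of "{p<..q}" "\<lambda>r. avg p r x"] assms by auto
  then have "r0 \<in> ?R"
    by (auto simp: is_arg_min_linorder)
  then have ne: "?R \<noteq> {}" "finite ?R"
    by auto
  define r where "r = Min ?R"
  have r: "r \<in> ?R"
    using Min_in[OF ne(2,1)] by (simp add: r_def)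
  moreover have "face p r x"
    unfolding face_def
  proof
    fix k assume k: "k \<in> {p<..<r}"
    have "k \<notin> ?R"
    proof
      assume "k \<in> ?R"
      then have "r \<le> k"
        unfolding r_def by (rule Min_le[OF ne(2)])
      with k show False by simp
    qed
    moreover have "k \<in> {p<..q}"
      using k r by auto
    ultimately obtain k' where "k' \<in> {p<..q}" "avg p k' x < avg p k x"
      by (auto simp: not_le)
    then show "avg p r x < avg p k x"
      using r by force
  qed
  ultimately show ?thesis
    using that by blast
qed

text \<open>The mean over \<open>{p<..k}\<close> is a weighted mean of those over
  \<open>{p<..r}\<close> and \<open>{r<..k}\<close>. Hence the slope of the first face bounds the
  later slopes from below.\<close>

lemma avg_tail_ge:
  assumes "p < r" "r < k" "avg p r x \<le> avg p k x"
  shows "avg p r x \<le> avg r k x"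
proof -
  have "real (k - p) * avg p r x \<le> real (k - p) * avg p k x"
    using assms by (intro mult_left_mono) auto
  also have "\<dots> = real (r - p) * avg p r x + real (k - r) * avg r k x"
    using assms avg_mult[of p k x] avg_mult[of p r x] avg_mult[of r k x]
      sum_greaterThanAtMost_split[of p r k x] by simp
  finally have "real (k - r) * avg p r x \<le> real (k - r) * avg r k x"
    using assms by (simp add: of_nat_diff algebra_simps)
  then show ?thesis
    using assms by simp
qed

lemma prob_space_normal_PiM:
  "0 < \<sigma> \<Longrightarrow> prob_space (Pi\<^sub>M I (\<lambda>_. density lborel (\<lambda>t. ennreal (normal_density 0 \<sigma> t))))"
  by (intro prob_space_PiM prob_space_normal_density)

lemma product_sigma_finite_normal:
  "0 < \<sigma> \<Longrightarrow> product_sigma_finite (\<lambda>_. density lborel (\<lambda>t. ennreal (normal_density 0 \<sigma> t)))"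
  using prob_space_normal_density by (simp add: product_sigma_finite_def prob_space_imp_sigma_finite)

lemma sets_normal_PiM:
  "sets (Pi\<^sub>M I (\<lambda>_. density lborel (\<lambda>t. ennreal (normal_density m \<sigma> t)))) = sets (Pi\<^sub>M I (\<lambda>_. borel))"
  by (intro sets_PiM_cong) auto

text \<open>The cycle lemma gives the factor \<open>1 / b\<close>, the law of the mean turns the
  integral into one over slopes, and tilting produces \<open>s\<close> and the new scale. The result
  has the form of a summand of \<open>nn_integral_spitzer\<close>.\<close>

lemma nn_integral_tilted_face_le:
  fixes \<sigma> l c :: real and f :: "real \<Rightarrow> real"
  assumes \<sigma>: "0 < \<sigma>" and l: "2 * l * \<sigma>\<^sup>2 < 1" and "p < r"
    and [measurable]: "f \<in> borel_measurable borel" and f: "\<And>t. 0 \<le> f t"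
  defines "s \<equiv> 1 / sqrt (1 - 2 * l * \<sigma>\<^sup>2)" and "b \<equiv> real (r - p)"
  shows "(\<integral>\<^sup>+x. indicator {x. face p r x} x * (indicator {c..} (avg p r x) *
        ennreal (exp (l * b * (avg p r x)\<^sup>2) * f (avg p r x)))
      \<partial>Pi\<^sub>M {p<..r} (\<lambda>_. density lborel (\<lambda>t. ennreal (normal_density 0 \<sigma> t))))
    \<le> (\<integral>\<^sup>+t. ennreal (s / b * normal_density 0 (\<sigma> * s / sqrt b) t * f t) * indicator {c..} t \<partial>lborel)"
proof -
  let ?N = "density lborel (\<lambda>t. ennreal (normal_density 0 \<sigma> t))"
  let ?g = "\<lambda>t. indicator {c..} t * ennreal (exp (l * b * t\<^sup>2) * f t)"
  have b: "0 < b"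
    using assms by simp
  let ?L = "\<integral>\<^sup>+x. indicator {x. face p r x} x * ?g (avg p r x) \<partial>Pi\<^sub>M {p<..r} (\<lambda>_. ?N)"
  let ?R = "\<integral>\<^sup>+t. ennreal (s / b * normal_density 0 (\<sigma> * s / sqrt b) t * f t) * indicator {c..} t \<partial>lborel"
  have "ennreal b * ?L \<le> (\<integral>\<^sup>+x. ?g (avg p r x) \<partial>Pi\<^sub>M {p<..r} (\<lambda>_. ?N))"
    unfolding b_def using \<sigma> \<open>p < r\<close> by (intro nn_integral_face_le prob_space_normal_density) auto
  also have "\<dots> = (\<integral>\<^sup>+t. ennreal (normal_density 0 (\<sigma> / sqrt b) t) * ?g t \<partial>lborel)"
    unfolding b_def by (rule distributed_nn_integral[symmetric, OF distributed_avg[OF \<sigma> \<open>p < r\<close>]]) measurable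
  also have "\<dots> = (\<integral>\<^sup>+t. ennreal b * (ennreal (s / b * normal_density 0 (\<sigma> * s / sqrt b) t * f t) * indicator {c..} t) \<partial>lborel)"
  proof (rule nn_integral_cong)
    fix t
    have "normal_density 0 (\<sigma> / sqrt b) t * (exp (l * b * t\<^sup>2) * f t) = s * normal_density 0 (\<sigma> * s / sqrt b) t * f t"
      using tilted_normal_density[OF \<sigma> b l, of t] by (simp add: s_def mult_ac)
    also have "\<dots> = b * (s / b * normal_density 0 (\<sigma> * s / sqrt b) t * f t)"
      using b by simp
    finally have eq: "normal_density 0 (\<sigma> / sqrt b) t * (exp (l * b * t\<^sup>2) * f t) =
        b * (s / b * normal_density 0 (\<sigma> * s / sqrt b) t * f t)" .
    have "ennreal (normal_density 0 (\<sigma> / sqrt b) t) * ennreal (exp (l * b * t\<^sup>2) * f t) =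
        ennreal b * ennreal (s / b * normal_density 0 (\<sigma> * s / sqrt b) t * f t)"
      using b unfolding ennreal_mult'[OF normal_density_nonneg, symmetric] eq by (intro ennreal_mult') simp
    then show "ennreal (normal_density 0 (\<sigma> / sqrt b) t) * ?g t =
        ennreal b * (ennreal (s / b * normal_density 0 (\<sigma> * s / sqrt b) t * f t) * indicator {c..} t)"
      by (simp add: indicator_def)
  qed
  also have "\<dots> = ennreal b * ?R"
    by (rule nn_integral_cmult) measurable
  finally show ?thesis
    using b ennreal_mult_le_mult_iff[of "ennreal b" ?L ?R] by simp
qed

text \<open>
  The parameter \<open>c\<close> bounds the slopes from below, so that the faces after the first one are
  controlled by the same statement with \<open>c\<close> the slope of the first face.
\<close>

lemma exp_majorant:
  fixes \<sigma> l :: real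
  assumes \<sigma>: "0 < \<sigma>" and l: "0 < l" "2 * l * \<sigma>\<^sup>2 < 1"
  defines "s \<equiv> 1 / sqrt (1 - 2 * l * \<sigma>\<^sup>2)" and "N \<equiv> density lborel (\<lambda>t. ennreal (normal_density 0 \<sigma> t))"
  assumes "p \<le> q"
  shows "\<exists>G :: real \<times> (nat \<Rightarrow> real) \<Rightarrow> ennreal.
    G \<in> borel_measurable (borel \<Otimes>\<^sub>M Pi\<^sub>M {p<..q} (\<lambda>_. borel)) \<and>
    (\<forall>c x v. (\<forall>r\<in>{p<..q}. c \<le> avg p r x) \<longrightarrow> (\<forall>i\<in>{p<..<q}. v i \<le> v (Suc i)) \<longrightarrow>
       ennreal (exp (l * (\<Sum>i\<in>{p<..q}. 2 * x i * v i - (v i)\<^sup>2))) \<le> G (c, restrict x {p<..q})) \<and>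
    (\<forall>c. (\<integral>\<^sup>+x. G (c, x) \<partial>Pi\<^sub>M {p<..q} (\<lambda>_. N)) \<le> ennreal (spitzer s (\<sigma> * s) (q - p) c))"
  using \<open>p \<le> q\<close>
proof (induction "q - p" arbitrary: p rule: less_induct)
  case less
  have s: "0 < s"
    using l by (simp add: s_def)
  have \<tau>: "0 < \<sigma> * s"
    using s \<sigma> by simp
  note [measurable] = borel_measurable_spitzer[OF \<tau>]
  show ?case
  proof (cases "p = q")
    case True
    interpret prob_space "Pi\<^sub>M {p<..q} (\<lambda>_. N)"
      unfolding N_def by (rule prob_space_normal_PiM[OF \<sigma>])
    show ?thesis
      using True emeasure_space_1 by (intro exI[of _ "\<lambda>_. 1"]) auto
  next
    case False
    then have "p < q" using less.prems by simp
    let ?PB = "\<lambda>I. Pi\<^sub>M I (\<lambda>_. borel) :: (nat \<Rightarrow> real) measure" and ?P = "\<lambda>I. Pi\<^sub>M I (\<lambda>_. N)"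
    define Q where "Q = (\<lambda>r (G :: real \<times> (nat \<Rightarrow> real) \<Rightarrow> ennreal).
      G \<in> borel_measurable (borel \<Otimes>\<^sub>M ?PB {r<..q}) \<and>
      (\<forall>c x v. (\<forall>k\<in>{r<..q}. c \<le> avg r k x) \<longrightarrow> (\<forall>i\<in>{r<..<q}. v i \<le> v (Suc i)) \<longrightarrow>
         ennreal (exp (l * (\<Sum>i\<in>{r<..q}. 2 * x i * v i - (v i)\<^sup>2))) \<le> G (c, restrict x {r<..q})) \<and>
      (\<forall>c. (\<integral>\<^sup>+x. G (c, x) \<partial>?P {r<..q}) \<le> ennreal (spitzer s (\<sigma> * s) (q - r) c)))"
    have "\<forall>r\<in>{p<..q}. \<exists>G. Q r G"
      unfolding Q_def by (intro ballI less.hyps) auto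
    then obtain G where QG: "\<And>r. r \<in> {p<..q} \<Longrightarrow> Q r (G r)"
      by metis
    have G: "\<And>r. r \<in> {p<..q} \<Longrightarrow> G r \<in> borel_measurable (borel \<Otimes>\<^sub>M ?PB {r<..q})"
      "\<And>r c x v. r \<in> {p<..q} \<Longrightarrow> (\<forall>k\<in>{r<..q}. c \<le> avg r k x) \<Longrightarrow> (\<forall>i\<in>{r<..<q}. v i \<le> v (Suc i)) \<Longrightarrow>
         ennreal (exp (l * (\<Sum>i\<in>{r<..q}. 2 * x i * v i - (v i)\<^sup>2))) \<le> G r (c, restrict x {r<..q})"
      "\<And>r c. r \<in> {p<..q} \<Longrightarrow> (\<integral>\<^sup>+x. G r (c, x) \<partial>?P {r<..q}) \<le> ennreal (spitzer s (\<sigma> * s) (q - r) c)"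
      using QG unfolding Q_def by blast+
    \<comment> \<open>\<open>w\<close> is the contribution of a first face ending at
      \<open>r\<close> with slope at least \<open>c\<close>; \<open>H\<close> multiplies it by the
      majorant for \<open>{r<..q}\<close>, whose lower slope bound is now the slope of that
      face.\<close>
    define w where "w = (\<lambda>r c x. indicator {x. face p r x} x * (indicator {c..} (avg p r x) *
        ennreal (exp (l * real (r - p) * (avg p r x)\<^sup>2))) :: ennreal)"
    define H where "H = (\<lambda>r (c, x). w r c x * G r (avg p r x, restrict x {r<..q}))"
    have wm: "(\<lambda>(c, x). w r c x) \<in> borel_measurable (borel \<Otimes>\<^sub>M ?PB I)" if "{p<..r} \<subseteq> I" for r I
    proof -
      note [measurable] = borel_measurable_avg[OF that] measurable_face[OF that]
      \<comment> \<open>Writing \<open>c \<le> avg p r x\<close> as a difference lying in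
        \<open>{0..}\<close> gives joint measurability in \<open>(c, x)\<close>.\<close>
      have "(\<lambda>z. indicator {x. face p r x} (snd z) * (indicator {0..} (avg p r (snd z) - fst z) *
        ennreal (exp (l * real (r - p) * (avg p r (snd z))\<^sup>2))) :: ennreal) \<in> borel_measurable (borel \<Otimes>\<^sub>M ?PB I)"
        by measurable
      also have "(\<lambda>z. indicator {x. face p r x} (snd z) * (indicator {0..} (avg p r (snd z) - fst z) *
        ennreal (exp (l * real (r - p) * (avg p r (snd z))\<^sup>2))) :: ennreal) = (\<lambda>(c, x). w r c x)"
        by (auto simp: fun_eq_iff w_def indicator_def)
      finally show ?thesis .
    qed
    have Hm: "H r \<in> borel_measurable (borel \<Otimes>\<^sub>M ?PB {p<..q})" if "r \<in> {p<..q}" for r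
    proof -
      have sub: "{p<..r} \<subseteq> {p<..q}" "{r<..q} \<subseteq> {p<..q}" using that by auto
      note [measurable] = borel_measurable_avg[OF sub(1)] G(1)[OF that] measurable_restrict_subset[OF sub(2), of "\<lambda>_. borel"]
        wm[OF sub(1), unfolded split_beta]
      show ?thesis
        unfolding H_def split_beta by measurable
    qed
    have int: "(\<integral>\<^sup>+x. H r (c, x) \<partial>?P {p<..q}) \<le>
      (\<integral>\<^sup>+t. ennreal (s / real (r - p) * normal_density 0 (\<sigma> * s / sqrt (real (r - p))) t
             * spitzer s (\<sigma> * s) (q - r) t) * indicator {c..} t \<partial>lborel)" if r: "r \<in> {p<..q}" for r c
    proof -
      have un: "{p<..q} = {p<..r} \<union> {r<..q}"
        using r by auto
      interpret product_sigma_finite "\<lambda>_. N"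
        unfolding N_def by (rule product_sigma_finite_normal[OF \<sigma>])
      have sets [measurable_cong]: "sets (?P I) = sets (?PB I)" for I
        unfolding N_def by (rule sets_normal_PiM)
      note [measurable] = Hm[OF r] G(1)[OF r]
      have Hc: "(\<lambda>x. H r (c, x)) \<in> borel_measurable (?P ({p<..r} \<union> {r<..q}))"
        unfolding un[symmetric] by measurable
      \<comment> \<open>Fubini separates the face, carried by \<open>x\<close>, from the rest of the
        block, carried by \<open>y\<close>.\<close>
      have "(\<integral>\<^sup>+x. H r (c, x) \<partial>?P {p<..q}) =
          (\<integral>\<^sup>+x. \<integral>\<^sup>+y. H r (c, merge {p<..r} {r<..q} (x, y)) \<partial>?P {r<..q} \<partial>?P {p<..r})"
        unfolding un by (rule product_nn_integral_fold[OF _ _ _ Hc]) auto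
      also have "\<dots> = (\<integral>\<^sup>+x. \<integral>\<^sup>+y. w r c x * G r (avg p r x, y) \<partial>?P {r<..q} \<partial>?P {p<..r})"
      proof (intro nn_integral_cong)
        fix x y assume "y \<in> space (?P {r<..q})"
        then have "restrict (merge {p<..r} {r<..q} (x, y)) {r<..q} = y"
          by (auto simp: space_PiM PiE_def extensional_def merge_def restrict_def fun_eq_iff)
        moreover have "face p r (merge {p<..r} {r<..q} (x, y)) = face p r x"
          by (rule face_cong) (auto simp: merge_def)
        moreover have "avg p r (merge {p<..r} {r<..q} (x, y)) = avg p r x"
          by (rule avg_cong) (auto simp: merge_def)
        ultimately show "H r (c, merge {p<..r} {r<..q} (x, y)) = w r c x * G r (avg p r x, y)"
          by (simp add: H_def w_def indicator_def)
      qed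
      also have "\<dots> = (\<integral>\<^sup>+x. w r c x * (\<integral>\<^sup>+y. G r (avg p r x, y) \<partial>?P {r<..q}) \<partial>?P {p<..r})"
        by (intro nn_integral_cong nn_integral_cmult) measurable
      also have "\<dots> \<le> (\<integral>\<^sup>+x. w r c x * ennreal (spitzer s (\<sigma> * s) (q - r) (avg p r x)) \<partial>?P {p<..r})"
        by (intro nn_integral_mono mult_left_mono G(3) r) auto
      also have "\<dots> = (\<integral>\<^sup>+x. indicator {x. face p r x} x * (indicator {c..} (avg p r x) *
        ennreal (exp (l * real (r - p) * (avg p r x)\<^sup>2) * spitzer s (\<sigma> * s) (q - r) (avg p r x))) \<partial>?P {p<..r})"
        using s \<tau> by (intro nn_integral_cong) (simp add: w_def ennreal_mult spitzer_nonneg mult_ac)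
      also have "\<dots> \<le> (\<integral>\<^sup>+t. ennreal (s / real (r - p) * normal_density 0 (\<sigma> * s / sqrt (real (r - p))) t
             * spitzer s (\<sigma> * s) (q - r) t) * indicator {c..} t \<partial>lborel)"
        by (rule nn_integral_tilted_face_le[OF \<sigma> l(2) _ borel_measurable_spitzer[OF \<tau>]
              spitzer_nonneg[OF \<tau> less_imp_le[OF s]], folded s_def N_def]) (use r in auto)
      finally show ?thesis .
    qed
    show ?thesis
    \<comment> \<open>The end of the first face varies with \<open>x\<close>, so the majorant sums
      over all possible ends; the other summands are nonnegative.\<close>
    proof (intro exI[of _ "\<lambda>z. \<Sum>r\<in>{p<..q}. H r z"] conjI allI impI)
      show "(\<lambda>z. \<Sum>r\<in>{p<..q}. H r z) \<in> borel_measurable (borel \<Otimes>\<^sub>M ?PB {p<..q})"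
        by (intro borel_measurable_sum Hm)
    next
      fix c :: real and x v :: "nat \<Rightarrow> real"
      assume c: "\<forall>r\<in>{p<..q}. c \<le> avg p r x" and v: "\<forall>i\<in>{p<..<q}. v i \<le> v (Suc i)"
      obtain r where r: "r \<in> {p<..q}" "face p r x" "\<And>k. k \<in> {p<..q} \<Longrightarrow> avg p r x \<le> avg p k x"
        using first_face_exists[OF \<open>p < q\<close>] by blast
      have av: "\<forall>k\<in>{r<..q}. avg p r x \<le> avg r k x"
        using r by (auto intro!: avg_tail_ge)
      have fb: "(\<Sum>i\<in>{p<..r}. 2 * x i * v i - (v i)\<^sup>2) \<le> real (r - p) * (avg p r x)\<^sup>2"
        using r v by (intro face_bound) auto
      have "l * (\<Sum>i\<in>{p<..q}. 2 * x i * v i - (v i)\<^sup>2) \<le>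
          l * real (r - p) * (avg p r x)\<^sup>2 + l * (\<Sum>i\<in>{r<..q}. 2 * x i * v i - (v i)\<^sup>2)"
        using sum_greaterThanAtMost_split[of p r q "\<lambda>i. 2 * x i * v i - (v i)\<^sup>2"] r
          mult_left_mono[OF fb, of l] l by (simp add: algebra_simps)
      then have "ennreal (exp (l * (\<Sum>i\<in>{p<..q}. 2 * x i * v i - (v i)\<^sup>2))) \<le>
          ennreal (exp (l * real (r - p) * (avg p r x)\<^sup>2)) * ennreal (exp (l * (\<Sum>i\<in>{r<..q}. 2 * x i * v i - (v i)\<^sup>2)))"
        by (simp add: ennreal_mult[symmetric] exp_add[symmetric])
      also have "\<dots> \<le> ennreal (exp (l * real (r - p) * (avg p r x)\<^sup>2)) * G r (avg p r x, restrict x {r<..q})"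
        using r v by (intro mult_left_mono G(2) av) auto
      also have "\<dots> = H r (c, restrict x {p<..q})"
      proof -
        have "avg p r (restrict x {p<..q}) = avg p r x"
          using r by (intro avg_cong) auto
        moreover have "face p r (restrict x {p<..q}) = face p r x"
          using r by (intro face_cong) auto
        moreover have "restrict (restrict x {p<..q}) {r<..q} = restrict x {r<..q}"
          using r by (auto simp: fun_eq_iff)
        ultimately show ?thesis
          using r c by (simp add: H_def w_def)
      qed
      also have "\<dots> \<le> (\<Sum>r\<in>{p<..q}. H r (c, restrict x {p<..q}))"
        using r by (intro member_le_sum) auto
      finally show "ennreal (exp (l * (\<Sum>i\<in>{p<..q}. 2 * x i * v i - (v i)\<^sup>2))) \<le>
          (\<Sum>r\<in>{p<..q}. H r (c, restrict x {p<..q}))" .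
    next
      fix c
      have sets [measurable_cong]: "sets (?P I) = sets (?PB I)" for I
        unfolding N_def by (rule sets_normal_PiM)
      have "(\<integral>\<^sup>+x. (\<Sum>r\<in>{p<..q}. H r (c, x)) \<partial>?P {p<..q}) = (\<Sum>r\<in>{p<..q}. \<integral>\<^sup>+x. H r (c, x) \<partial>?P {p<..q})"
      proof (rule nn_integral_sum)
        fix r assume "r \<in> {p<..q}"
        note [measurable] = Hm[OF this]
        show "(\<lambda>x. H r (c, x)) \<in> borel_measurable (?P {p<..q})"
          by measurable
      qed
      also have "\<dots> \<le> (\<Sum>r\<in>{p<..q}. \<integral>\<^sup>+t. ennreal (s / real (r - p) * normal_density 0 (\<sigma> * s / sqrt (real (r - p))) t
             * spitzer s (\<sigma> * s) (q - r) t) * indicator {c..} t \<partial>lborel)"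
        by (intro sum_mono int)
      \<comment> \<open>Reindexing by the remaining length \<open>j = q - r\<close>.\<close>
      also have "\<dots> = (\<Sum>j<q - p. \<integral>\<^sup>+t. ennreal (s / real (q - p - j) * normal_density 0 (\<sigma> * s / sqrt (real (q - p - j))) t
             * spitzer s (\<sigma> * s) j t) * indicator {c..} t \<partial>lborel)"
        by (rule sum.reindex_bij_witness[of _ "\<lambda>j. q - j" "\<lambda>r. q - r"]) (auto simp: diff_right_commute)
      also have "\<dots> = ennreal (spitzer s (\<sigma> * s) (q - p) c)"
        using \<tau> s \<open>p < q\<close> by (intro nn_integral_spitzer) auto
      finally show "(\<integral>\<^sup>+x. (\<Sum>r\<in>{p<..q}. H r (c, x)) \<partial>?P {p<..q}) \<le> ennreal (spitzer s (\<sigma> * s) (q - p) c)" .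
    qed
  qed
qed

section \<open>Exponential moment over the constancy blocks\<close>

text \<open>The slope constraint is removed by letting \<open>c\<close> tend to minus infinity,
  since the bound on the integral is uniform in \<open>c\<close>. \<open>G\<close> dominates for all
  \<open>v\<close> at once, so \<open>v\<close> may later depend on \<open>x\<close>, as the
  projection error does.\<close>

lemma exp_majorant_monotone:
  fixes \<sigma> l :: real
  assumes \<sigma>: "0 < \<sigma>" and l: "0 < l" "2 * l * \<sigma>\<^sup>2 < 1"
  defines "s \<equiv> 1 / sqrt (1 - 2 * l * \<sigma>\<^sup>2)" and "N \<equiv> density lborel (\<lambda>t. ennreal (normal_density 0 \<sigma> t))"
  assumes "p < q"
  shows "\<exists>G :: (nat \<Rightarrow> real) \<Rightarrow> ennreal. G \<in> borel_measurable (Pi\<^sub>M {p<..q} (\<lambda>_. borel)) \<and>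
    (\<forall>x v. (\<forall>i\<in>{p<..<q}. v i \<le> v (Suc i)) \<longrightarrow>
       ennreal (exp (l * (\<Sum>i\<in>{p<..q}. 2 * x i * v i - (v i)\<^sup>2))) \<le> G (restrict x {p<..q})) \<and>
    (\<integral>\<^sup>+x. G x \<partial>Pi\<^sub>M {p<..q} (\<lambda>_. N)) \<le> ennreal (exp ((s - 1) * (1 + ln (real (q - p)))))"
proof -
  let ?PB = "Pi\<^sub>M {p<..q} (\<lambda>_. borel) :: (nat \<Rightarrow> real) measure" and ?P = "Pi\<^sub>M {p<..q} (\<lambda>_. N)"
  have "0 < l * \<sigma>\<^sup>2"
    using \<sigma> l by simp
  then have "sqrt (1 - 2 * l * \<sigma>\<^sup>2) \<le> 1"
    by simp
  then have s: "1 \<le> s"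
    using l by (simp add: s_def)
  obtain G :: "real \<times> (nat \<Rightarrow> real) \<Rightarrow> ennreal" where
    Gm [measurable]: "G \<in> borel_measurable (borel \<Otimes>\<^sub>M ?PB)" and
    Gd: "\<forall>c x v. (\<forall>r\<in>{p<..q}. c \<le> avg p r x) \<longrightarrow> (\<forall>i\<in>{p<..<q}. v i \<le> v (Suc i)) \<longrightarrow>
       ennreal (exp (l * (\<Sum>i\<in>{p<..q}. 2 * x i * v i - (v i)\<^sup>2))) \<le> G (c, restrict x {p<..q})" and
    Gi: "\<forall>c. (\<integral>\<^sup>+x. G (c, x) \<partial>?P) \<le> ennreal (spitzer s (\<sigma> * s) (q - p) c)"
    using exp_majorant[OF \<sigma> l less_imp_le[OF \<open>p < q\<close>], folded s_def N_def] by blast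
  have [measurable_cong]: "sets ?P = sets ?PB"
    unfolding N_def by (rule sets_normal_PiM)
  have bd: "(\<integral>\<^sup>+x. G (c, x) \<partial>?P) \<le> ennreal (exp ((s - 1) * (1 + ln (real (q - p)))))" for c
  proof -
    have "spitzer s (\<sigma> * s) (q - p) c \<le> exp ((s - 1) * (1 + ln (real (q - p))))"
      using spitzer_le_prod[of "\<sigma> * s" s "q - p" c] prod_le_exp_ln[OF s, of "q - p"] \<sigma> s \<open>p < q\<close> by auto
    with Gi show ?thesis
      by (meson ennreal_leI order_trans)
  qed
  \<comment> \<open>For fixed \<open>x\<close> only finitely many means occur, so
    \<open>c = - k\<close> is admissible for all large \<open>k\<close>; the lower limit keeps
    measurability, and Fatou's lemma keeps the bound.\<close>
  define L where "L = (\<lambda>x. liminf (\<lambda>k. G (- real k, x)))"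
  show ?thesis
  proof (intro exI[of _ L] conjI allI impI)
    show "L \<in> borel_measurable ?PB"
      unfolding L_def by measurable
  next
    fix x v :: "nat \<Rightarrow> real"
    assume v: "\<forall>i\<in>{p<..<q}. v i \<le> v (Suc i)"
    have "\<forall>\<^sub>F k in sequentially. - real k \<le> avg p r x" for r
      by (rule eventually_sequentiallyI[of "nat \<lceil>- avg p r x\<rceil>"]) linarith
    then have "\<forall>\<^sub>F k in sequentially. \<forall>r\<in>{p<..q}. - real k \<le> avg p r x"
      by (intro eventually_ball_finite) auto
    then have "\<forall>\<^sub>F k in sequentially. ennreal (exp (l * (\<Sum>i\<in>{p<..q}. 2 * x i * v i - (v i)\<^sup>2))) \<le>
        G (- real k, restrict x {p<..q})"
      by (rule eventually_mono) (use Gd v in blast)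
    then show "ennreal (exp (l * (\<Sum>i\<in>{p<..q}. 2 * x i * v i - (v i)\<^sup>2))) \<le> L (restrict x {p<..q})"
      unfolding L_def by (rule Liminf_bounded)
  next
    have "(\<integral>\<^sup>+x. L x \<partial>?P) \<le> liminf (\<lambda>k. \<integral>\<^sup>+x. G (- real k, x) \<partial>?P)"
      unfolding L_def by (rule nn_integral_liminf) measurable
    also have "\<dots> \<le> liminf (\<lambda>k. ennreal (exp ((s - 1) * (1 + ln (real (q - p))))))"
      by (intro Liminf_mono always_eventually allI bd)
    finally show "(\<integral>\<^sup>+x. L x \<partial>?P) \<le> ennreal (exp ((s - 1) * (1 + ln (real (q - p)))))"
      by (simp add: Liminf_const)
  qed
qed

text \<open>
  Replacing \<open>1 + ln m\<close> by an affine majorant makes the bound additive over blocks; the tangent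
  at \<open>m = n / k\<close> then gives \<open>k ln (e n / k)\<close>.
\<close>

lemma exp_majorant_blocks:
  fixes \<sigma> l \<alpha> \<beta> :: real and J :: "nat set"
  assumes \<sigma>: "0 < \<sigma>" and l: "0 < l" "2 * l * \<sigma>\<^sup>2 < 1"
  defines "s \<equiv> 1 / sqrt (1 - 2 * l * \<sigma>\<^sup>2)" and "N \<equiv> density lborel (\<lambda>t. ennreal (normal_density 0 \<sigma> t))"
  assumes lin: "\<And>m::nat. 0 < m \<Longrightarrow> 1 + ln (real m) \<le> \<alpha> + \<beta> * real m" and "p < q"
  shows "\<exists>G :: (nat \<Rightarrow> real) \<Rightarrow> ennreal. G \<in> borel_measurable (Pi\<^sub>M {p<..q} (\<lambda>_. borel)) \<and>
    (\<forall>x v. (\<forall>i\<in>{p<..<q}. i \<notin> J \<longrightarrow> v i \<le> v (Suc i)) \<longrightarrow>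
       ennreal (exp (l * (\<Sum>i\<in>{p<..q}. 2 * x i * v i - (v i)\<^sup>2))) \<le> G (restrict x {p<..q})) \<and>
    (\<integral>\<^sup>+x. G x \<partial>Pi\<^sub>M {p<..q} (\<lambda>_. N)) \<le>
      ennreal (exp ((s - 1) * (\<alpha> * real (card (J \<inter> {p<..<q}) + 1) + \<beta> * real (q - p))))"
  using \<open>p < q\<close>
proof (induction "q - p" arbitrary: p rule: less_induct)
  case less
  let ?PB = "\<lambda>I. Pi\<^sub>M I (\<lambda>_. borel) :: (nat \<Rightarrow> real) measure" and ?P = "\<lambda>I. Pi\<^sub>M I (\<lambda>_. N)"
  have "0 < l * \<sigma>\<^sup>2"
    using \<sigma> l by simp
  then have "sqrt (1 - 2 * l * \<sigma>\<^sup>2) \<le> 1"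
    by simp
  then have s: "1 \<le> s"
    using l by (simp add: s_def)
  have mono: "\<exists>G :: (nat \<Rightarrow> real) \<Rightarrow> ennreal. G \<in> borel_measurable (?PB {p<..r}) \<and>
    (\<forall>x v. (\<forall>i\<in>{p<..<r}. v i \<le> v (Suc i)) \<longrightarrow>
       ennreal (exp (l * (\<Sum>i\<in>{p<..r}. 2 * x i * v i - (v i)\<^sup>2))) \<le> G (restrict x {p<..r})) \<and>
    (\<integral>\<^sup>+x. G x \<partial>?P {p<..r}) \<le> ennreal (exp ((s - 1) * (\<alpha> + \<beta> * real (r - p))))" if "p < r" for r
  proof -
    have "ennreal (exp ((s - 1) * (1 + ln (real (r - p))))) \<le> ennreal (exp ((s - 1) * (\<alpha> + \<beta> * real (r - p))))"
      using s lin[of "r - p"] that by (intro ennreal_leI) (auto intro!: mult_left_mono)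
    then show ?thesis
      using exp_majorant_monotone[OF \<sigma> l that, folded s_def N_def] order_trans by blast
  qed
  show ?case
  proof (cases "J \<inter> {p<..<q} = {}")
    case True
    then have "\<And>i. i \<in> {p<..<q} \<Longrightarrow> i \<notin> J"
      by auto
    then show ?thesis
      using mono[OF less.prems] True by (simp del: greaterThanLessThan_iff)
  next
    case False
    \<comment> \<open>At the first jump the first block ends: \<open>v\<close> is nondecreasing
      inside \<open>{p<..r}\<close>, and nothing is required of the step from \<open>r\<close> to
      \<open>r + 1\<close>.\<close>
    define r where "r = Min (J \<inter> {p<..<q})"
    have r: "r \<in> J" "p < r" "r < q"
      using Min_in[OF _ False] by (auto simp: r_def)
    have rmin: "i \<notin> J" if "i \<in> {p<..<r}" for i
    proof
      assume "i \<in> J"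
      then have "r \<le> i"
        unfolding r_def using that r by (intro Min_le) auto
      with that show False by simp
    qed
    obtain G1 :: "(nat \<Rightarrow> real) \<Rightarrow> ennreal" where G1m [measurable]: "G1 \<in> borel_measurable (?PB {p<..r})" and
      G1d: "\<forall>x v. (\<forall>i\<in>{p<..<r}. v i \<le> v (Suc i)) \<longrightarrow>
       ennreal (exp (l * (\<Sum>i\<in>{p<..r}. 2 * x i * v i - (v i)\<^sup>2))) \<le> G1 (restrict x {p<..r})" and
      G1i: "(\<integral>\<^sup>+x. G1 x \<partial>?P {p<..r}) \<le> ennreal (exp ((s - 1) * (\<alpha> + \<beta> * real (r - p))))"
      using mono[OF r(2)] by blast
    obtain G2 :: "(nat \<Rightarrow> real) \<Rightarrow> ennreal" where G2m [measurable]: "G2 \<in> borel_measurable (?PB {r<..q})" and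
      G2d: "\<forall>x v. (\<forall>i\<in>{r<..<q}. i \<notin> J \<longrightarrow> v i \<le> v (Suc i)) \<longrightarrow>
       ennreal (exp (l * (\<Sum>i\<in>{r<..q}. 2 * x i * v i - (v i)\<^sup>2))) \<le> G2 (restrict x {r<..q})" and
      G2i: "(\<integral>\<^sup>+x. G2 x \<partial>?P {r<..q}) \<le>
        ennreal (exp ((s - 1) * (\<alpha> * real (card (J \<inter> {r<..<q}) + 1) + \<beta> * real (q - r))))"
      using less.hyps[OF diff_less_mono2[OF r(2) less.prems] r(3)] by blast
    have un: "{p<..q} = {p<..r} \<union> {r<..q}"
      using r by auto
    have sets [measurable_cong]: "sets (?P I) = sets (?PB I)" for I
      unfolding N_def by (rule sets_normal_PiM)
    have sub: "{p<..r} \<subseteq> {p<..q}" "{r<..q} \<subseteq> {p<..q}"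
      using r by auto
    note [measurable] = measurable_restrict_subset[OF sub(1), of "\<lambda>_. borel"] measurable_restrict_subset[OF sub(2), of "\<lambda>_. borel"]
    \<comment> \<open>The two factors use disjoint coordinates, so the integral of the product
      factorises.\<close>
    define G where "G = (\<lambda>x. G1 (restrict x {p<..r}) * G2 (restrict x {r<..q}))"
    have Gm: "G \<in> borel_measurable (?PB {p<..q})"
      unfolding G_def by measurable
    show ?thesis
    proof (intro exI[of _ G] conjI allI impI Gm)
      fix x v :: "nat \<Rightarrow> real"
      assume v: "\<forall>i\<in>{p<..<q}. i \<notin> J \<longrightarrow> v i \<le> v (Suc i)"
      have "ennreal (exp (l * (\<Sum>i\<in>{p<..q}. 2 * x i * v i - (v i)\<^sup>2))) =
          ennreal (exp (l * (\<Sum>i\<in>{p<..r}. 2 * x i * v i - (v i)\<^sup>2))) *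
          ennreal (exp (l * (\<Sum>i\<in>{r<..q}. 2 * x i * v i - (v i)\<^sup>2)))"
        using sum_greaterThanAtMost_split[of p r q "\<lambda>i. 2 * x i * v i - (v i)\<^sup>2"] r
        by (simp add: ennreal_mult[symmetric] exp_add[symmetric] algebra_simps)
      also have "\<dots> \<le> G1 (restrict x {p<..r}) * G2 (restrict x {r<..q})"
      proof (rule mult_mono)
        show "ennreal (exp (l * (\<Sum>i\<in>{p<..r}. 2 * x i * v i - (v i)\<^sup>2))) \<le> G1 (restrict x {p<..r})"
          using v rmin r by (intro G1d[rule_format]) auto
        show "ennreal (exp (l * (\<Sum>i\<in>{r<..q}. 2 * x i * v i - (v i)\<^sup>2))) \<le> G2 (restrict x {r<..q})"
          using v r by (intro G2d[rule_format]) auto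
      qed auto
      also have "\<dots> = G (restrict x {p<..q})"
        using r by (simp add: G_def min_absorb2 max_absorb2)
      finally show "ennreal (exp (l * (\<Sum>i\<in>{p<..q}. 2 * x i * v i - (v i)\<^sup>2))) \<le> G (restrict x {p<..q})" .
    next
      interpret product_sigma_finite "\<lambda>_. N"
        unfolding N_def by (rule product_sigma_finite_normal[OF \<sigma>])
      have Gc: "G \<in> borel_measurable (?P ({p<..r} \<union> {r<..q}))"
        unfolding un[symmetric] using Gm by measurable
      have "(\<integral>\<^sup>+x. G x \<partial>?P {p<..q}) =
          (\<integral>\<^sup>+x. \<integral>\<^sup>+y. G (merge {p<..r} {r<..q} (x, y)) \<partial>?P {r<..q} \<partial>?P {p<..r})"
        unfolding un by (rule product_nn_integral_fold[OF _ _ _ Gc]) auto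
      also have "\<dots> = (\<integral>\<^sup>+x. \<integral>\<^sup>+y. G1 x * G2 y \<partial>?P {r<..q} \<partial>?P {p<..r})"
      proof (intro nn_integral_cong)
        fix x y assume "x \<in> space (?P {p<..r})" "y \<in> space (?P {r<..q})"
        then have "restrict (merge {p<..r} {r<..q} (x, y)) {r<..q} = y" "restrict (merge {p<..r} {r<..q} (x, y)) {p<..r} = x"
          by (auto simp: space_PiM PiE_def extensional_def merge_def restrict_def fun_eq_iff)
        then show "G (merge {p<..r} {r<..q} (x, y)) = G1 x * G2 y"
          by (simp add: G_def)
      qed
      also have "\<dots> = (\<integral>\<^sup>+x. G1 x \<partial>?P {p<..r}) * (\<integral>\<^sup>+y. G2 y \<partial>?P {r<..q})"
        by (simp add: nn_integral_cmult nn_integral_multc)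
      also have "\<dots> \<le> ennreal (exp ((s - 1) * (\<alpha> + \<beta> * real (r - p)))) *
          ennreal (exp ((s - 1) * (\<alpha> * real (card (J \<inter> {r<..<q}) + 1) + \<beta> * real (q - r))))"
        by (intro mult_mono G1i G2i) auto
      also have "\<dots> = ennreal (exp ((s - 1) * (\<alpha> * real (card (J \<inter> {p<..<q}) + 1) + \<beta> * real (q - p))))"
      proof -
        \<comment> \<open>The jump \<open>r\<close> is the only one missing from the remaining
          range; it accounts for the \<open>\<alpha>\<close> of the first block.\<close>
        have "J \<inter> {p<..<q} = insert r (J \<inter> {r<..<q})"
          using r rmin by (auto simp: not_less_iff_gr_or_eq) (metis greaterThanLessThan_iff linorder_neqE_nat)
        then have "card (J \<inter> {p<..<q}) = card (J \<inter> {r<..<q}) + 1"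
          by simp
        moreover have "real (q - p) = real (r - p) + real (q - r)"
          using r by simp
        ultimately show ?thesis
          by (simp add: ennreal_mult[symmetric] exp_add[symmetric] algebra_simps)
      qed
      finally show "(\<integral>\<^sup>+x. G x \<partial>?P {p<..q}) \<le>
        ennreal (exp ((s - 1) * (\<alpha> * real (card (J \<inter> {p<..<q}) + 1) + \<beta> * real (q - p))))" .
    qed
  qed
qed

lemma num_pieces_le: "0 < n \<Longrightarrow> num_pieces n u \<le> n"
proof -
  assume "0 < n"
  have "card {i \<in> {1..n-1}. u i < u (i + 1)} \<le> card {1..n-1}"
    by (intro card_mono) auto
  then show ?thesis
    using \<open>0 < n\<close> by (simp add: num_pieces_def)
qed

lemma exp_majorant_pieces:
  fixes \<sigma> l :: real
  assumes \<sigma>: "0 < \<sigma>" and l: "0 < l" "2 * l * \<sigma>\<^sup>2 < 1" and "0 < n" and u: "u \<in> monotone_cone n"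
  defines "s \<equiv> 1 / sqrt (1 - 2 * l * \<sigma>\<^sup>2)" and "k \<equiv> real (num_pieces n u)"
  shows "\<exists>G :: (nat \<Rightarrow> real) \<Rightarrow> ennreal. G \<in> borel_measurable (Pi\<^sub>M {1..n} (\<lambda>_. borel)) \<and>
    (\<forall>x v. (\<forall>i\<in>{1..n-1}. u i = u (i + 1) \<longrightarrow> v i \<le> v (i + 1)) \<longrightarrow>
       ennreal (exp (l * (\<Sum>i=1..n. 2 * x i * v i - (v i)\<^sup>2))) \<le> G (restrict x {1..n})) \<and>
    (\<integral>\<^sup>+x. G x \<partial>isotropic_gaussian n \<sigma>) \<le> ennreal (exp ((s - 1) * (k * ln (exp 1 * real n / k))))"
proof -
  have k: "0 < k" "k \<le> real n"
    using num_pieces_le[OF \<open>0 < n\<close>, of u] by (simp_all add: k_def) (simp add: num_pieces_def)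
  define J where "J = {i \<in> {1..n-1}. u i < u (i + 1)}"
  \<comment> \<open>The tangent to \<open>1 + ln m\<close> at \<open>m = n / k\<close> fixes
    \<open>\<alpha> = ln (n / k)\<close> and \<open>\<beta> = k / n\<close>.\<close>
  have lin: "1 + ln (real m) \<le> ln (real n / k) + k / real n * real m" if "0 < m" for m :: nat
  proof -
    have "ln (real m * k / real n) \<le> real m * k / real n - 1"
      using that k \<open>0 < n\<close> by (intro ln_le_minus_one) auto
    then show ?thesis
      using that k \<open>0 < n\<close> by (simp add: ln_mult ln_div field_simps)
  qed
  have ivl: "{0<..n} = {1..n}" "{0<..<n} = {1..n-1}"
    using \<open>0 < n\<close> by auto
  have "J \<inter> {1..n-1} = J"
    by (auto simp: J_def)
  then have card: "real (card (J \<inter> {1..n-1}) + 1) = k"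
    by (simp add: k_def num_pieces_def J_def)
  have bound: "ln (real n / k) * k + k / real n * real n = k * ln (exp 1 * real n / k)"
    using k \<open>0 < n\<close> by (simp add: ln_mult ln_div field_simps)
  obtain G :: "(nat \<Rightarrow> real) \<Rightarrow> ennreal" where G: "G \<in> borel_measurable (Pi\<^sub>M {1..n} (\<lambda>_. borel))"
    "\<forall>x v. (\<forall>i\<in>{1..n-1}. i \<notin> J \<longrightarrow> v i \<le> v (Suc i)) \<longrightarrow>
       ennreal (exp (l * (\<Sum>i\<in>{1..n}. 2 * x i * v i - (v i)\<^sup>2))) \<le> G (restrict x {1..n})"
    "(\<integral>\<^sup>+x. G x \<partial>Pi\<^sub>M {1..n} (\<lambda>_. density lborel (\<lambda>t. ennreal (normal_density 0 \<sigma> t)))) \<le>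
      ennreal (exp ((s - 1) * (k * ln (exp 1 * real n / k))))"
    using exp_majorant_blocks[OF \<sigma> l lin \<open>0 < n\<close>, of J, folded s_def, unfolded ivl card diff_zero bound]
    by blast
  have "i \<notin> J \<longrightarrow> u i = u (i + 1)" if "i \<in> {1..n-1}" for i
    using u that by (force simp: J_def monotone_cone_def)
  then show ?thesis
    using G unfolding isotropic_gaussian_def by (intro exI[of _ G]) auto
qed

section \<open>The projection onto the monotone cone and the oracle\<close>

lemma scaled_norm_sq: "(scaled_norm n v)\<^sup>2 = (\<Sum>i=1..n. (v i)\<^sup>2) / real n"
  by (simp add: scaled_norm_def sum_nonneg)

lemma least_squares_mem: "is_least_squares n K z m \<Longrightarrow> m \<in> K"
  by (simp add: is_least_squares_def is_arg_min_def)

text \<open>First-order optimality: the cone is convex, and if the inner product were positive, a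
  small step from \<open>m\<close> towards \<open>w\<close> would bring the point closer to
  \<open>z\<close>.\<close>

lemma least_squares_variational:
  assumes "0 < n" and m: "is_least_squares n (monotone_cone n) z m" and w: "w \<in> monotone_cone n"
  shows "(\<Sum>i=1..n. (z i - m i) * (w i - m i)) \<le> 0"
proof (rule ccontr)
  define A where "A = (\<Sum>i=1..n. (z i - m i) * (w i - m i))"
  define B where "B = (\<Sum>i=1..n. (w i - m i)\<^sup>2)"
  assume "\<not> ?thesis"
  then have A: "0 < A"
    by (simp add: A_def)
  have B: "0 \<le> B"
    by (simp add: B_def sum_nonneg)
  \<comment> \<open>The step changes the squared distance by \<open>- 2 e A + e^2 B\<close>. This
    \<open>e\<close> satisfies \<open>e \<le> 1\<close> and \<open>e * B \<le> A\<close> even when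
    \<open>B = 0\<close>, so the change is negative.\<close>
  define e where "e = A / (A + B)"
  have e: "0 < e" "e \<le> 1"
    using A B by (auto simp: e_def)
  have mK: "m \<in> monotone_cone n"
    using m by (rule least_squares_mem)
  define v where "v = (\<lambda>i\<in>{1..n}. m i + e * (w i - m i))"
  have "v \<in> monotone_cone n"
    unfolding monotone_cone_def
  proof (intro CollectI conjI ballI)
    show "v \<in> Rn n"
      by (simp add: v_def Rn_def)
    fix i assume i: "i \<in> {1..n-1}"
    then have "(1 - e) * m i + e * w i \<le> (1 - e) * m (i + 1) + e * w (i + 1)"
      using e mK w by (intro add_mono mult_left_mono) (auto simp: monotone_cone_def)
    moreover have "i \<in> {1..n}" "i + 1 \<in> {1..n}"
      using i by auto
    ultimately show "v i \<le> v (i + 1)"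
      by (simp add: v_def algebra_simps)
  qed
  then have "(\<Sum>i=1..n. (z i - m i)\<^sup>2) \<le> (\<Sum>i=1..n. (z i - v i)\<^sup>2)"
    using m \<open>0 < n\<close> unfolding is_least_squares_def is_arg_min_linorder scaled_norm_sq
    by (auto simp: divide_le_cancel)
  also have "\<dots> = (\<Sum>i=1..n. (z i - m i)\<^sup>2 - 2 * e * ((z i - m i) * (w i - m i)) + e\<^sup>2 * (w i - m i)\<^sup>2)"
    by (intro sum.cong) (auto simp: v_def power2_eq_square algebra_simps)
  also have "\<dots> = (\<Sum>i=1..n. (z i - m i)\<^sup>2) - 2 * e * A + e\<^sup>2 * B"
    by (simp add: sum.distrib sum_subtractf sum_distrib_left A_def B_def)
  finally have "e * (2 * A) \<le> e * (e * B)"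
    by (simp add: power2_eq_square algebra_simps)
  then have "2 * A \<le> e * B"
    using e by simp
  also have "e * B \<le> A"
    using A B by (simp add: e_def field_simps)
  finally show False
    using A by simp
qed

text \<open>Expanding the squares, the right-hand side minus the left-hand side is \<open>-2\<close>
  times the sum in the variational inequality at \<open>u\<close>.\<close>

lemma least_squares_basic_inequality:
  assumes "0 < n" and m: "is_least_squares n (monotone_cone n) z m" and u: "u \<in> monotone_cone n"
    and z: "\<And>i. i \<in> {1..n} \<Longrightarrow> z i = \<mu> i + x i"
  shows "(\<Sum>i=1..n. (m i - \<mu> i)\<^sup>2) - (\<Sum>i=1..n. (u i - \<mu> i)\<^sup>2)
    \<le> (\<Sum>i=1..n. 2 * x i * (m i - u i) - (m i - u i)\<^sup>2)"
proof -
  have "(\<Sum>i=1..n. 2 * x i * (m i - u i) - (m i - u i)\<^sup>2) - ((\<Sum>i=1..n. (m i - \<mu> i)\<^sup>2) - (\<Sum>i=1..n. (u i - \<mu> i)\<^sup>2))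
     = (\<Sum>i=1..n. - 2 * ((z i - m i) * (u i - m i)))"
    unfolding sum_subtractf[symmetric]
    by (intro sum.cong) (auto simp: z power2_eq_square algebra_simps)
  also have "\<dots> = - 2 * (\<Sum>i=1..n. (z i - m i) * (u i - m i))"
    by (simp add: sum_distrib_left)
  finally show ?thesis
    using least_squares_variational[OF assms(1) m u] by simp
qed

section \<open>Lipschitz continuity and measurability of the estimator\<close>

text \<open>The variational inequalities of \<open>m\<close> and \<open>m'\<close>, each tested at
  the other point, are added and combined with the nonnegativity of the square of
  \<open>(z' - z) - (m' - m)\<close>.\<close>

lemma least_squares_nonexpansive:
  assumes "0 < n" and m: "is_least_squares n (monotone_cone n) z m" and m': "is_least_squares n (monotone_cone n) z' m'"
  shows "(\<Sum>i=1..n. (m' i - m i)\<^sup>2) \<le> (\<Sum>i=1..n. (z' i - z i)\<^sup>2)"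
proof -
  have "(\<Sum>i=1..n. (z i - m i) * (m' i - m i)) + (\<Sum>i=1..n. (z' i - m' i) * (m i - m' i)) \<le> 0"
    using least_squares_variational[OF assms(1) m least_squares_mem[OF m']]
      least_squares_variational[OF assms(1) m' least_squares_mem[OF m]] by simp
  moreover have "(\<Sum>i=1..n. (m' i - m i)\<^sup>2) - (\<Sum>i=1..n. (z' i - z i)\<^sup>2) \<le>
      2 * ((\<Sum>i=1..n. (z i - m i) * (m' i - m i)) + (\<Sum>i=1..n. (z' i - m' i) * (m i - m' i)))"
    unfolding sum_subtractf[symmetric] sum.distrib[symmetric] sum_distrib_left
  proof (rule sum_mono)
    fix i
    have "0 \<le> ((z' i - z i) - (m' i - m i))\<^sup>2"
      by simp
    then show "(m' i - m i)\<^sup>2 - (z' i - z i)\<^sup>2 \<le> 2 * ((z i - m i) * (m' i - m i) + (z' i - m' i) * (m i - m' i))"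
      by (simp add: power2_eq_square algebra_simps)
  qed
  ultimately show ?thesis by simp
qed

lemma continuous_least_squares:
  assumes "0 < n" and mu_hat: "\<And>z. z \<in> Rn n \<Longrightarrow> is_least_squares n (monotone_cone n) z (mu_hat z)"
    and i: "i \<in> {1..n}"
  shows "continuous_on UNIV (\<lambda>x. mu_hat (restrict x {1..n}) i)"
proof -
  have "isCont (\<lambda>x. mu_hat (restrict x {1..n}) i) x" for x
  proof -
    define g where "g = (\<lambda>y::nat \<Rightarrow> real. sqrt (\<Sum>j=1..n. (y j - x j)\<^sup>2))"
    have le: "norm (mu_hat (restrict y {1..n}) i - mu_hat (restrict x {1..n}) i) \<le> g y" for y
    proof -
      let ?a = "mu_hat (restrict y {1..n})" and ?b = "mu_hat (restrict x {1..n})"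
      have "(?a i - ?b i)\<^sup>2 \<le> (\<Sum>j=1..n. (?a j - ?b j)\<^sup>2)"
        using i by (intro member_le_sum) auto
      also have "\<dots> \<le> (\<Sum>j=1..n. (restrict y {1..n} j - restrict x {1..n} j)\<^sup>2)"
        by (intro least_squares_nonexpansive \<open>0 < n\<close> mu_hat) (auto simp: Rn_def)
      also have "\<dots> = (\<Sum>j=1..n. (y j - x j)\<^sup>2)"
        by (intro sum.cong) auto
      finally have "sqrt ((?a i - ?b i)\<^sup>2) \<le> g y"
        unfolding g_def by (rule real_sqrt_le_mono)
      then show ?thesis by simp
    qed
    have "continuous_on UNIV g"
      unfolding g_def by (intro continuous_intros continuous_on_product_coordinates)
    then have "isCont g x"
      by (simp add: continuous_on_eq_continuous_at)
    then have "(g \<longlongrightarrow> 0) (at x)"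
      by (simp add: isCont_def g_def)
    then have "((\<lambda>y. mu_hat (restrict y {1..n}) i - mu_hat (restrict x {1..n}) i) \<longlongrightarrow> 0) (at x)"
      by (rule Lim_null_comparison[rotated]) (intro always_eventually allI le)
    then show ?thesis
      unfolding isCont_def by (rule LIM_zero_cancel)
  qed
  then show ?thesis
    by (simp add: continuous_on_eq_continuous_at)
qed

lemma measurable_least_squares:
  assumes "0 < n" and mu_hat: "\<And>z. z \<in> Rn n \<Longrightarrow> is_least_squares n (monotone_cone n) z (mu_hat z)"
    and Y: "Y \<in> M \<rightarrow>\<^sub>M (\<Pi>\<^sub>M i\<in>{1..n}. borel)" and i: "i \<in> {1..n}"
  shows "(\<lambda>\<omega>. mu_hat (Y \<omega>) i) \<in> borel_measurable M"
proof -
  \<comment> \<open>Coordinates outside \<open>{1..n}\<close> are set to 0, which makes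
    \<open>?Z\<close> Borel measurable on the whole function type; restriction undoes the
    change.\<close>
  let ?Z = "\<lambda>\<omega> j. if j \<in> {1..n} then Y \<omega> j else 0"
  have Yj: "(\<lambda>\<omega>. Y \<omega> j) \<in> borel_measurable M" if "j \<in> {1..n}" for j
    using Y measurable_component_singleton[OF that, of "\<lambda>_. borel"] by (rule measurable_compose)
  have Z: "?Z \<in> borel_measurable M"
  proof (rule measurable_coordinatewise_then_product)
    fix j
    show "(\<lambda>\<omega>. ?Z \<omega> j) \<in> borel_measurable M"
      by (cases "j \<in> {1..n}") (simp_all only: Yj if_True if_False borel_measurable_const)
  qed
  have "(\<lambda>x. mu_hat (restrict x {1..n}) i) \<in> borel_measurable borel"
    by (intro borel_measurable_continuous_onI continuous_least_squares[OF \<open>0 < n\<close> mu_hat i])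
  then have "(\<lambda>\<omega>. mu_hat (restrict (?Z \<omega>) {1..n}) i) \<in> borel_measurable M"
    by (rule measurable_compose[OF Z])
  moreover have "mu_hat (restrict (?Z \<omega>) {1..n}) i = mu_hat (Y \<omega>) i" if "\<omega> \<in> space M" for \<omega>
  proof -
    have "Y \<omega> \<in> {1..n} \<rightarrow>\<^sub>E UNIV"
      using measurable_space[OF Y that] by (simp add: space_PiM)
    then have "restrict (?Z \<omega>) {1..n} = Y \<omega>"
      by (auto simp: fun_eq_iff PiE_def extensional_def)
    then show ?thesis by simp
  qed
  ultimately show ?thesis
    by (simp cong: measurable_cong)
qed

section \<open>Existence of the minimisers of the oracle risk\<close>

text \<open>\<open>J\<close> holds the positions where a jump is allowed. Competitors no farther
  from \<open>\<mu>\<close> than the zero vector lie in a compact box, and the constraints are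
  closed, so the continuous distance attains its minimum.\<close>

lemma ex_nearest_monotone:
  fixes \<mu> :: "nat \<Rightarrow> real" and J :: "nat set" and n :: nat
  defines "K \<equiv> {u \<in> monotone_cone n. \<forall>i\<in>{1..n-1}. i \<notin> J \<longrightarrow> u i = u (i + 1)}"
  shows "\<exists>u\<in>K. \<forall>w\<in>K. (\<Sum>i=1..n. (u i - \<mu> i)\<^sup>2) \<le> (\<Sum>i=1..n. (w i - \<mu> i)\<^sup>2)"
proof -
  define f where "f = (\<lambda>u::nat \<Rightarrow> real. \<Sum>i=1..n. (u i - \<mu> i)\<^sup>2)"
  define z where "z = (\<lambda>i\<in>{1..n}. 0 :: real)"
  define R where "R = sqrt (f z)"
  \<comment> \<open>Coordinates outside \<open>{1..n}\<close> are pinned to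
    \<open>undefined\<close>, so \<open>C\<close> is a product of compact sets over all naturals,
    compact by Tychonoff's theorem.\<close>
  define C where "C = (\<Pi>\<^sub>E i\<in>UNIV. if i \<in> {1..n} then {\<mu> i - R..\<mu> i + R} else {undefined})"
  let ?L = "(\<Inter>i\<in>{1..n-1}. {u :: nat \<Rightarrow> real. u i \<le> u (i + 1)}) \<inter> (\<Inter>i\<in>{1..n-1} - J. {u. u i = u (i + 1)})"
  have near: "\<bar>u i - \<mu> i\<bar> \<le> R" if "f u \<le> f z" "i \<in> {1..n}" for u i
  proof -
    have "(u i - \<mu> i)\<^sup>2 \<le> f u"
      unfolding f_def using that by (intro member_le_sum) auto
    with that have "sqrt ((u i - \<mu> i)\<^sup>2) \<le> R"
      unfolding R_def by (intro real_sqrt_le_mono) simp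
    then show ?thesis by simp
  qed
  have inC: "u \<in> C" if "u \<in> Rn n" "f u \<le> f z" for u
  proof -
    have *: "u i \<in> (if i \<in> {1..n} then {\<mu> i - R..\<mu> i + R} else {undefined})" for i
    proof (cases "i \<in> {1..n}")
      case True
      then show ?thesis
        using near[OF that(2) True] by (auto simp: abs_le_iff)
    next
      case False
      then show ?thesis
        using PiE_arb[OF that(1)[unfolded Rn_def] False] by (simp only: if_False singleton_iff)
    qed
    show ?thesis
      unfolding C_def by (rule PiE_I[OF *]) simp
  qed
  have CL: "C \<inter> ?L = K \<inter> C"
  proof -
    have "u \<in> Rn n" if "u \<in> C" for u
    proof -
      have "u i = undefined" if "i \<notin> {1..n}" for i
        using PiE_mem[OF \<open>u \<in> C\<close>[unfolded C_def], of i] that by (simp only: if_False UNIV_I singleton_iff)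
      then show ?thesis
        by (simp add: Rn_def PiE_def extensional_def)
    qed
    then show ?thesis
      unfolding K_def monotone_cone_def by blast
  qed
  have K_Rn: "u \<in> Rn n" if "u \<in> K" for u
    using that by (simp add: K_def monotone_cone_def)
  have zK: "z \<in> K"
    by (auto simp: K_def monotone_cone_def z_def Rn_def)
  have "compactin (product_topology (\<lambda>_. euclidean) UNIV) C"
    unfolding C_def compactin_PiE by (intro disjI2 ballI) simp
  then have "compact C"
    by (simp only: euclidean_product_topology compactin_euclidean_iff)
  moreover have "closed ?L"
    by (rule closed_Int; rule closed_INT; rule ballI;
        (rule closed_Collect_le | rule closed_Collect_eq); rule continuous_on_product_coordinates)
  ultimately have comp: "compact (C \<inter> ?L)"
    by (rule compact_Int_closed)
  have z: "z \<in> C \<inter> ?L"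
    unfolding CL using inC[OF K_Rn[OF zK]] zK by simp
  have "continuous_on UNIV f"
    unfolding f_def
    by (intro continuous_on_sum continuous_on_power continuous_on_diff continuous_on_const continuous_on_product_coordinates)
  then have cont: "continuous_on (C \<inter> ?L) f"
    by (rule continuous_on_subset) simp
  define S where "S = C \<inter> ?L"
  have "S \<noteq> {}"
    using z unfolding S_def[symmetric] by auto
  then obtain u where u: "u \<in> S" "\<And>w. w \<in> S \<Longrightarrow> f u \<le> f w"
    using continuous_attains_inf[of S f] comp cont unfolding S_def[symmetric] by blast
  have SK: "S = K \<inter> C"
    unfolding S_def by (rule CL)
  have "f u \<le> f w" if "w \<in> K" for w
  proof (cases "f w \<le> f z")
    case True
    then show ?thesis
      using that inC[OF K_Rn[OF that]] u(2) by (simp add: SK)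
  next
    case False
    then show ?thesis
      using u(2)[of z] z unfolding S_def[symmetric] by simp
  qed
  moreover have "u \<in> K"
    using u(1) by (simp add: SK)
  ultimately show ?thesis
    unfolding f_def by blast
qed

text \<open>The derivative of \<open>a ln (e n / a)\<close> is \<open>ln (n / a)\<close>,
  nonnegative for \<open>a \<le> n\<close>. Thus having fewer pieces never raises the
  penalty.\<close>

lemma mult_ln_mono:
  fixes a b n :: real
  assumes "0 < a" "a \<le> b" "b \<le> n"
  shows "a * ln (exp 1 * n / a) \<le> b * ln (exp 1 * n / b)"
proof -
  have "ln (b / a) \<le> b / a - 1"
    using assms by (intro ln_le_minus_one) auto
  then have "a * (ln b - ln a) \<le> b - a"
    using assms by (simp add: ln_div field_simps)
  moreover have "0 \<le> (b - a) * (ln n - ln b)"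
    using assms by (intro mult_nonneg_nonneg) auto
  moreover have "ln (exp 1 * n / a) = 1 + ln n - ln a" "ln (exp 1 * n / b) = 1 + ln n - ln b"
    using assms by (simp_all add: ln_mult ln_div)
  ultimately show ?thesis
    by (simp only:) (simp add: algebra_simps)
qed

text \<open>The piece count is discontinuous in \<open>u\<close>, so compactness is applied
  separately for each of the finitely many allowed jump sets \<open>J\<close>, and then the best
  \<open>J\<close> is chosen.\<close>

lemma ex_oracle_argmin:
  fixes c \<sigma> :: real
  assumes "0 < n" "0 \<le> c"
  shows "\<exists>u. is_arg_min (oracle_risk c n \<sigma> \<mu>) (\<lambda>u. u \<in> monotone_cone n) u"
proof -
  define K where "K = (\<lambda>J. {u \<in> monotone_cone n. \<forall>i\<in>{1..n-1}. i \<notin> J \<longrightarrow> u i = u (i + 1)})"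
  define jumps where "jumps = (\<lambda>u::nat \<Rightarrow> real. {i \<in> {1..n-1}. u i < u (i + 1)})"
  define f where "f = (\<lambda>u::nat \<Rightarrow> real. \<Sum>i=1..n. (u i - \<mu> i)\<^sup>2)"
  define \<kappa> where "\<kappa> = (\<lambda>k::nat. real k * ln (exp 1 * real n / real k))"
  have risk: "oracle_risk c n \<sigma> \<mu> u = (f u + c * \<sigma>\<^sup>2 * \<kappa> (card (jumps u) + 1)) / real n" for u
    by (simp add: oracle_risk_def scaled_norm_sq f_def \<kappa>_def num_pieces_def jumps_def add_divide_distrib)
  have "\<forall>J. \<exists>u. u \<in> K J \<and> (\<forall>w\<in>K J. f u \<le> f w)"
    using ex_nearest_monotone[of n _ \<mu>] unfolding K_def f_def by blast
  then obtain U where U: "\<And>J. U J \<in> K J" "\<And>J w. w \<in> K J \<Longrightarrow> f (U J) \<le> f w"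
    by metis
  define obj where "obj = (\<lambda>J. (f (U J) + c * \<sigma>\<^sup>2 * \<kappa> (card J + 1)) / real n)"
  obtain J where J: "J \<in> Pow {1..n-1}" "\<And>J'. J' \<in> Pow {1..n-1} \<Longrightarrow> obj J \<le> obj J'"
    using ex_is_arg_min_if_finite[of "Pow {1..n-1}" obj] by (auto simp: is_arg_min_linorder)
  \<comment> \<open>\<open>U J\<close> may jump at fewer places than \<open>J\<close> allows; its
    penalty is at most the one charged in \<open>obj J\<close>.\<close>
  have "oracle_risk c n \<sigma> \<mu> (U J) \<le> obj J"
  proof -
    have "jumps (U J) \<subseteq> J"
      using U(1)[of J] by (fastforce simp: jumps_def K_def)
    moreover have fin: "finite J"
      using J(1) finite_subset by auto
    ultimately have "card (jumps (U J)) \<le> card J"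
      by (intro card_mono)
    moreover have "card J \<le> n - 1"
      using card_mono[of "{1..n-1}" J] J(1) by simp
    ultimately have "\<kappa> (card (jumps (U J)) + 1) \<le> \<kappa> (card J + 1)"
      unfolding \<kappa>_def using \<open>0 < n\<close> by (intro mult_ln_mono) auto
    then show ?thesis
      unfolding risk obj_def using assms by (intro divide_right_mono add_left_mono mult_left_mono) auto
  qed
  also have "obj J \<le> oracle_risk c n \<sigma> \<mu> w" if w: "w \<in> monotone_cone n" for w
  proof -
    \<comment> \<open>Every \<open>w\<close> competes in the problem of its own jump set, where its
      penalty is charged exactly.\<close>
    have "w \<in> K (jumps w)"
      using w by (force simp: K_def jumps_def monotone_cone_def)
    then have "obj (jumps w) \<le> oracle_risk c n \<sigma> \<mu> w"
      unfolding risk obj_def by (intro divide_right_mono add_right_mono U(2)) auto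
    moreover have "obj J \<le> obj (jumps w)"
      by (rule J(2)) (auto simp: jumps_def)
    ultimately show ?thesis by simp
  qed
  finally have "\<forall>w. w \<in> monotone_cone n \<longrightarrow> oracle_risk c n \<sigma> \<mu> (U J) \<le> oracle_risk c n \<sigma> \<mu> w"
    by blast
  moreover have "U J \<in> monotone_cone n"
    using U(1)[of J] by (simp add: K_def)
  ultimately show ?thesis
    by (auto simp: is_arg_min_linorder)
qed

section \<open>The oracle inequalities\<close>

text \<open>Where \<open>u\<close> is constant, \<open>mu_hat (y \<omega>) - u\<close> inherits
  monotonicity from the projection, so the majorant applies at the noise with this random
  \<open>v\<close>.\<close>

lemma least_squares_exp_moment:
  fixes M :: "'a measure" and l \<sigma> :: real
  assumes \<sigma>: "0 < \<sigma>" and l: "0 < l" "2 * l * \<sigma>\<^sup>2 < 1" and "0 < n"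
    and \<xi> [measurable]: "\<xi> \<in> M \<rightarrow>\<^sub>M (\<Pi>\<^sub>M i\<in>{1..n}. borel)"
    and distr: "distr M (\<Pi>\<^sub>M i\<in>{1..n}. borel) \<xi> = isotropic_gaussian n \<sigma>"
    and y: "\<And>\<omega>. \<omega> \<in> space M \<Longrightarrow> y \<omega> = (\<lambda>i\<in>{1..n}. \<mu> i + \<xi> \<omega> i)"
    and mu_hat: "\<And>z. z \<in> Rn n \<Longrightarrow> is_least_squares n (monotone_cone n) z (mu_hat z)"
    and u: "u \<in> monotone_cone n"
  defines "s \<equiv> 1 / sqrt (1 - 2 * l * \<sigma>\<^sup>2)" and "k \<equiv> real (num_pieces n u)"
  shows "(\<integral>\<^sup>+\<omega>. ennreal (exp (l * ((\<Sum>i=1..n. (mu_hat (y \<omega>) i - \<mu> i)\<^sup>2) - (\<Sum>i=1..n. (u i - \<mu> i)\<^sup>2)))) \<partial>M)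
    \<le> ennreal (exp ((s - 1) * (k * ln (exp 1 * real n / k))))"
proof -
  obtain G :: "(nat \<Rightarrow> real) \<Rightarrow> ennreal" where
    Gm [measurable]: "G \<in> borel_measurable (Pi\<^sub>M {1..n} (\<lambda>_. borel))" and
    Gd: "\<forall>x v. (\<forall>i\<in>{1..n-1}. u i = u (i + 1) \<longrightarrow> v i \<le> v (i + 1)) \<longrightarrow>
       ennreal (exp (l * (\<Sum>i=1..n. 2 * x i * v i - (v i)\<^sup>2))) \<le> G (restrict x {1..n})" and
    Gi: "(\<integral>\<^sup>+x. G x \<partial>isotropic_gaussian n \<sigma>) \<le> ennreal (exp ((s - 1) * (k * ln (exp 1 * real n / k))))"
    using exp_majorant_pieces[OF \<sigma> l \<open>0 < n\<close> u, folded s_def k_def] by blast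
  have "(\<integral>\<^sup>+\<omega>. ennreal (exp (l * ((\<Sum>i=1..n. (mu_hat (y \<omega>) i - \<mu> i)\<^sup>2) - (\<Sum>i=1..n. (u i - \<mu> i)\<^sup>2)))) \<partial>M)
      \<le> (\<integral>\<^sup>+\<omega>. G (\<xi> \<omega>) \<partial>M)"
  proof (rule nn_integral_mono)
    fix \<omega> assume \<omega>: "\<omega> \<in> space M"
    let ?m = "mu_hat (y \<omega>)"
    have "y \<omega> \<in> Rn n"
      using y[OF \<omega>] by (simp add: Rn_def)
    note m = mu_hat[OF this]
    have mono: "\<forall>i\<in>{1..n-1}. u i = u (i + 1) \<longrightarrow> ?m i - u i \<le> ?m (i + 1) - u (i + 1)"
      using least_squares_mem[OF m] by (auto simp: monotone_cone_def)
    have "(\<Sum>i=1..n. (?m i - \<mu> i)\<^sup>2) - (\<Sum>i=1..n. (u i - \<mu> i)\<^sup>2)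
        \<le> (\<Sum>i=1..n. 2 * \<xi> \<omega> i * (?m i - u i) - (?m i - u i)\<^sup>2)"
      by (rule least_squares_basic_inequality[OF \<open>0 < n\<close> m u]) (simp add: y[OF \<omega>])
    then have "ennreal (exp (l * ((\<Sum>i=1..n. (?m i - \<mu> i)\<^sup>2) - (\<Sum>i=1..n. (u i - \<mu> i)\<^sup>2))))
        \<le> ennreal (exp (l * (\<Sum>i=1..n. 2 * \<xi> \<omega> i * (?m i - u i) - (?m i - u i)\<^sup>2)))"
      using l by (intro ennreal_leI) simp
    also have "\<dots> \<le> G (restrict (\<xi> \<omega>) {1..n})"
      by (rule Gd[rule_format]) (use mono in blast)
    also have "restrict (\<xi> \<omega>) {1..n} = \<xi> \<omega>"
      using measurable_space[OF \<xi> \<omega>] by (simp add: space_PiM PiE_restrict)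
    finally show "ennreal (exp (l * ((\<Sum>i=1..n. (?m i - \<mu> i)\<^sup>2) - (\<Sum>i=1..n. (u i - \<mu> i)\<^sup>2)))) \<le> G (\<xi> \<omega>)" .
  qed
  also have "\<dots> = (\<integral>\<^sup>+x. G x \<partial>isotropic_gaussian n \<sigma>)"
    unfolding distr[symmetric] by (rule nn_integral_distr[symmetric]) measurable
  finally show ?thesis
    using Gi by simp
qed

text \<open>The inequality \<open>1 + t \<le> exp t\<close> at \<open>t = l * (X - a) - B\<close>
  takes the place of Jensen's inequality: the mean of \<open>exp t\<close> is at most 1. The same
  inequality at \<open>l * (X - a)\<close> dominates \<open>X\<close> and gives
  integrability.\<close>

lemma (in prob_space) expectation_le_of_exp_moment:
  fixes X :: "'a \<Rightarrow> real"
  assumes [measurable]: "random_variable borel X" and X: "\<And>\<omega>. 0 \<le> X \<omega>" and "0 < l"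
    and exp_moment: "(\<integral>\<^sup>+\<omega>. ennreal (exp (l * (X \<omega> - a))) \<partial>M) \<le> ennreal (exp B)"
  shows "integrable M X" "expectation X - a \<le> B / l"
proof -
  have ie: "integrable M (\<lambda>\<omega>. exp (l * (X \<omega> - a)))"
    using exp_moment by (intro integrableI_nonneg) (auto simp: le_less_trans[OF _ ennreal_less_top])
  show iX: "integrable M X"
  proof (rule Bochner_Integration.integrable_bound)
    show "integrable M (\<lambda>\<omega>. \<bar>a\<bar> + exp (l * (X \<omega> - a)) / l)"
      using ie by simp
    show "AE \<omega> in M. norm (X \<omega>) \<le> norm (\<bar>a\<bar> + exp (l * (X \<omega> - a)) / l)"
    proof (rule AE_I2)
      fix \<omega>
      have "l * (X \<omega> - a) \<le> exp (l * (X \<omega> - a))"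
        using exp_ge_add_one_self[of "l * (X \<omega> - a)"] by linarith
      then have "X \<omega> - a \<le> exp (l * (X \<omega> - a)) / l"
        using \<open>0 < l\<close> by (simp add: field_simps)
      then show "norm (X \<omega>) \<le> norm (\<bar>a\<bar> + exp (l * (X \<omega> - a)) / l)"
        using X[of \<omega>] by simp
    qed
  qed simp
  have "expectation (\<lambda>\<omega>. exp (l * (X \<omega> - a))) \<le> exp B"
    using exp_moment ie by (subst (asm) nn_integral_eq_integral) auto
  then have "expectation (\<lambda>\<omega>. exp (l * (X \<omega> - a)) / exp B) \<le> 1"
    by simp
  moreover have "expectation (\<lambda>\<omega>. 1 + (l * (X \<omega> - a) - B)) \<le> expectation (\<lambda>\<omega>. exp (l * (X \<omega> - a)) / exp B)"
  proof (rule integral_mono)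
    show "1 + (l * (X \<omega> - a) - B) \<le> exp (l * (X \<omega> - a)) / exp B" for \<omega>
      using exp_ge_add_one_self[of "l * (X \<omega> - a) - B"] by (simp add: exp_diff)
  qed (use iX ie in auto)
  moreover have "expectation (\<lambda>\<omega>. 1 + (l * (X \<omega> - a) - B)) = 1 + (l * (expectation X - a) - B)"
    using iX by (simp add: prob_space)
  ultimately have "l * (expectation X - a) \<le> B"
    by linarith
  then show "expectation X - a \<le> B / l"
    using \<open>0 < l\<close> by (simp add: field_simps)
qed

text \<open>Chernoff's bound, that is, Markov's inequality for the exponential.\<close>

lemma (in prob_space) prob_le_of_exp_moment:
  fixes X :: "'a \<Rightarrow> real"
  assumes [measurable]: "random_variable borel X" and "0 < l"
    and exp_moment: "(\<integral>\<^sup>+\<omega>. ennreal (exp (l * (X \<omega> - a))) \<partial>M) \<le> ennreal (exp B)"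
  shows "prob {\<omega> \<in> space M. a + t < X \<omega>} \<le> exp (B - l * t)"
proof -
  let ?A = "{\<omega> \<in> space M. a + t < X \<omega>}"
  have "ennreal (exp (l * t)) * emeasure M ?A = (\<integral>\<^sup>+\<omega>. ennreal (exp (l * t)) * indicator ?A \<omega> \<partial>M)"
    by (simp add: nn_integral_cmult_indicator)
  also have "\<dots> \<le> (\<integral>\<^sup>+\<omega>. ennreal (exp (l * (X \<omega> - a))) \<partial>M)"
    using \<open>0 < l\<close> by (intro nn_integral_mono) (auto simp: indicator_def)
  also note exp_moment
  finally have "exp (l * t) * prob ?A \<le> exp B"
    by (simp add: emeasure_eq_measure ennreal_mult'[symmetric])
  then show ?thesis
    by (simp add: exp_diff field_simps)
qed

text \<open>This is the difference quotient at 0 of \<open>(1 - 2 l \<sigma>^2) powr (-1/2)\<close>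
  as a function of \<open>l\<close>, whose derivative there is \<open>\<sigma>^2\<close>.\<close>

lemma tilt_rate_tendsto:
  fixes \<sigma> :: real
  shows "((\<lambda>l. (1 / sqrt (1 - 2 * l * \<sigma>\<^sup>2) - 1) / l) \<longlongrightarrow> \<sigma>\<^sup>2) (at_right 0)"
proof -
  have "((\<lambda>l. 1 / sqrt (1 - 2 * l * \<sigma>\<^sup>2)) has_real_derivative \<sigma>\<^sup>2) (at 0)"
    by (auto intro!: derivative_eq_intros)
  then have "((\<lambda>l. (1 / sqrt (1 - 2 * l * \<sigma>\<^sup>2) - 1) / l) \<longlongrightarrow> \<sigma>\<^sup>2) (at 0)"
    by (simp add: DERIV_def)
  then show ?thesis
    by (rule filterlim_mono) (auto simp: at_le)
qed

theorem theorem3p2: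
  fixes M :: "'a measure"
    and \<sigma> :: real and n :: nat
    and \<mu> :: "nat \<Rightarrow> real"
    and \<xi> y :: "'a \<Rightarrow> nat \<Rightarrow> real"
    and mu_hat :: "(nat \<Rightarrow> real) \<Rightarrow> nat \<Rightarrow> real"
  assumes "prob_space M"
    and "\<sigma> > 0"
    and "n \<ge> 2"
    and "\<mu> \<in> Rn n"
    and "\<xi> \<in> M \<rightarrow>\<^sub>M (\<Pi>\<^sub>M i\<in>{1..n}. borel)"
    and "distr M (\<Pi>\<^sub>M i\<in>{1..n}. borel) \<xi> = isotropic_gaussian n \<sigma>"
    and "\<And>\<omega>. \<omega> \<in> space M \<Longrightarrow> y \<omega> = (\<lambda>i\<in>{1..n}. \<mu> i + \<xi> \<omega> i)"
    and "\<And>z. z \<in> Rn n \<Longrightarrow> is_least_squares n (monotone_cone n) z (mu_hat z)"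
  shows
    "integrable M (\<lambda>\<omega>. (scaled_norm n (\<lambda>i. mu_hat (y \<omega>) i - \<mu> i))\<^sup>2) \<and>
     (\<exists>u. is_arg_min (oracle_risk 1 n \<sigma> \<mu>) (\<lambda>u. u \<in> monotone_cone n) u \<and>
       prob_space.expectation M (\<lambda>\<omega>. (scaled_norm n (\<lambda>i. mu_hat (y \<omega>) i - \<mu> i))\<^sup>2)
         \<le> oracle_risk 1 n \<sigma> \<mu> u) \<and>
     (\<exists>u. is_arg_min (oracle_risk 2 n \<sigma> \<mu>) (\<lambda>u. u \<in> monotone_cone n) u \<and>
       (\<forall>x>0. prob_space.prob M
          {\<omega> \<in> space M. (scaled_norm n (\<lambda>i. mu_hat (y \<omega>) i - \<mu> i))\<^sup>2
              \<le> oracle_risk 2 n \<sigma> \<mu> u + 4 * \<sigma>\<^sup>2 * x / real n}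
        > 1 - exp (- x)))"
proof -
  interpret prob_space M by fact
  have n: "0 < n"
    using \<open>n \<ge> 2\<close> by simp
  define X where "X = (\<lambda>\<omega>. \<Sum>i=1..n. (mu_hat (y \<omega>) i - \<mu> i)\<^sup>2)"
  define f where "f = (\<lambda>u. \<Sum>i=1..n. (u i - \<mu> i)\<^sup>2)"
  define \<kappa> where "\<kappa> = (\<lambda>u. real (num_pieces n u) * ln (exp 1 * real n / real (num_pieces n u)))"
  have loss: "(scaled_norm n (\<lambda>i. mu_hat (y \<omega>) i - \<mu> i))\<^sup>2 = X \<omega> / real n" for \<omega>
    by (simp add: scaled_norm_sq X_def)
  have risk: "oracle_risk c n \<sigma> \<mu> u = (f u + c * \<sigma>\<^sup>2 * \<kappa> u) / real n" for c u
    by (simp add: oracle_risk_def scaled_norm_sq f_def \<kappa>_def add_divide_distrib)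
  \<comment> \<open>Positivity of \<open>\<kappa>\<close> makes the probability bound
    strict.\<close>
  have \<kappa>: "0 < \<kappa> u" for u
  proof -
    have k: "0 < real (num_pieces n u)" "real (num_pieces n u) \<le> real n"
      using num_pieces_le[OF n, of u] by (simp_all add: num_pieces_def)
    moreover have "ln (exp 1 * real n / real (num_pieces n u)) = 1 + ln (real n) - ln (real (num_pieces n u))"
      using k n by (simp add: ln_mult ln_div)
    moreover have "ln (real (num_pieces n u)) \<le> ln (real n)"
      using k by simp
    ultimately show ?thesis
      unfolding \<kappa>_def by (intro mult_pos_pos) linarith+
  qed
  have Y: "y \<in> M \<rightarrow>\<^sub>M (\<Pi>\<^sub>M i\<in>{1..n}. borel)"
  proof -
    have "(\<lambda>\<omega>. \<lambda>i\<in>{1..n}. \<mu> i + \<xi> \<omega> i) \<in> M \<rightarrow>\<^sub>M (\<Pi>\<^sub>M i\<in>{1..n}. borel)"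
    proof (rule measurable_restrict)
      fix i assume "i \<in> {1..n}"
      from measurable_compose[OF assms(5) measurable_component_singleton[OF this, of "\<lambda>_. borel"]]
      show "(\<lambda>\<omega>. \<mu> i + \<xi> \<omega> i) \<in> borel_measurable M"
        by simp
    qed
    then show ?thesis
      using assms(7) by (simp cong: measurable_cong)
  qed
  have X_measurable [measurable]: "random_variable borel X"
    unfolding X_def
    by (intro borel_measurable_sum borel_measurable_power borel_measurable_diff borel_measurable_const
          measurable_least_squares[OF n assms(8) Y])
  have X_nonneg: "0 \<le> X \<omega>" for \<omega>
    by (simp add: X_def sum_nonneg)
  have moment: "(\<integral>\<^sup>+\<omega>. ennreal (exp (l * (X \<omega> - f u))) \<partial>M) \<le> ennreal (exp ((1 / sqrt (1 - 2 * l * \<sigma>\<^sup>2) - 1) * \<kappa> u))"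
    if "u \<in> monotone_cone n" "0 < l" "2 * l * \<sigma>\<^sup>2 < 1" for u l
    unfolding X_def f_def \<kappa>_def
    by (rule least_squares_exp_moment[OF assms(2) that(2,3) n assms(5-8) that(1)])
  obtain u1 u2 where
    u1: "is_arg_min (oracle_risk 1 n \<sigma> \<mu>) (\<lambda>u. u \<in> monotone_cone n) u1" and
    u2: "is_arg_min (oracle_risk 2 n \<sigma> \<mu>) (\<lambda>u. u \<in> monotone_cone n) u2"
    using ex_oracle_argmin[OF n, of 1 \<sigma> \<mu>] ex_oracle_argmin[OF n, of 2 \<sigma> \<mu>] by auto
  have mem: "u1 \<in> monotone_cone n" "u2 \<in> monotone_cone n"
    using u1 u2 by (auto simp: is_arg_min_def)
  \<comment> \<open>With this tilt \<open>1 - 2 l \<sigma>^2 = 1 / 2\<close>, so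
    \<open>s = sqrt 2\<close>.\<close>
  define l where "l = 1 / (4 * \<sigma>\<^sup>2)"
  have l: "0 < l" "2 * l * \<sigma>\<^sup>2 = 1 / 2"
    using \<open>\<sigma> > 0\<close> by (auto simp: l_def)
  have int: "integrable M X"
    using expectation_le_of_exp_moment(1)[OF X_measurable X_nonneg l(1) moment[OF mem(1) l(1)]] l by simp
  \<comment> \<open>The bound \<open>(s - 1) / l * \<kappa> u1\<close> holds for every admissible
    \<open>l\<close>; its limit from the right at 0 has the constant 1 in front of the variance
    term.\<close>
  have "expectation X - f u1 \<le> \<sigma>\<^sup>2 * \<kappa> u1"
  proof (rule tendsto_lowerbound)
    show "((\<lambda>l. (1 / sqrt (1 - 2 * l * \<sigma>\<^sup>2) - 1) / l * \<kappa> u1) \<longlongrightarrow> \<sigma>\<^sup>2 * \<kappa> u1) (at_right 0)"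
      by (intro tendsto_mult tilt_rate_tendsto tendsto_const)
    \<comment> \<open>The upper end is \<open>1 / (2 \<sigma>^2)\<close>, where
      \<open>2 l \<sigma>^2\<close> reaches 1.\<close>
    have "\<forall>\<^sub>F l in at_right 0. l \<in> {0<..<2 * (1 / (4 * \<sigma>\<^sup>2))}"
      using l by (intro eventually_at_right_real) (simp add: l_def)
    then show "\<forall>\<^sub>F l in at_right 0. expectation X - f u1 \<le> (1 / sqrt (1 - 2 * l * \<sigma>\<^sup>2) - 1) / l * \<kappa> u1"
    proof (rule eventually_mono)
      fix l assume "l \<in> {0<..<2 * (1 / (4 * \<sigma>\<^sup>2))}"
      then have "0 < l" "2 * l * \<sigma>\<^sup>2 < 1"
        using \<open>\<sigma> > 0\<close> by (auto simp: field_simps)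
      from expectation_le_of_exp_moment(2)[OF X_measurable X_nonneg this(1) moment[OF mem(1) this]]
      show "expectation X - f u1 \<le> (1 / sqrt (1 - 2 * l * \<sigma>\<^sup>2) - 1) / l * \<kappa> u1"
        by simp
    qed
  qed simp
  then have expect: "expectation (\<lambda>\<omega>. X \<omega> / real n) \<le> oracle_risk 1 n \<sigma> \<mu> u1"
    using n unfolding risk by (simp add: divide_right_mono)
  have prob: "1 - exp (- x) < prob {\<omega> \<in> space M. X \<omega> / real n \<le> oracle_risk 2 n \<sigma> \<mu> u2 + 4 * \<sigma>\<^sup>2 * x / real n}" for x
  proof -
    \<comment> \<open>\<open>t\<close> is the variance and deviation terms of the bound multiplied
      by \<open>n\<close>; the constants 2 and 4 match \<open>l\<close>, so that
      \<open>l * t\<close> is \<open>\<kappa> u2 / 2 + x\<close>.\<close>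
    define t where "t = 2 * \<sigma>\<^sup>2 * \<kappa> u2 + 4 * \<sigma>\<^sup>2 * x"
    have "l * t = \<kappa> u2 / 2 + x"
      using \<open>\<sigma> > 0\<close> by (simp add: l_def t_def field_simps)
    moreover have "1 / sqrt (1 - 2 * l * \<sigma>\<^sup>2) - 1 < 1 / 2"
    proof -
      have "sqrt 2 < 3 / 2"
        by (rule real_less_lsqrt) (auto simp: power2_eq_square)
      then show ?thesis
        unfolding l(2) by (simp add: real_sqrt_divide)
    qed
    ultimately have "(1 / sqrt (1 - 2 * l * \<sigma>\<^sup>2) - 1) * \<kappa> u2 - l * t < - x"
      using \<kappa>[of u2] mult_strict_right_mono[of "1 / sqrt (1 - 2 * l * \<sigma>\<^sup>2) - 1" "1 / 2" "\<kappa> u2"] by simp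
    moreover have "prob {\<omega> \<in> space M. f u2 + t < X \<omega>} \<le> exp ((1 / sqrt (1 - 2 * l * \<sigma>\<^sup>2) - 1) * \<kappa> u2 - l * t)"
      by (rule prob_le_of_exp_moment[OF X_measurable l(1) moment[OF mem(2) l(1)]]) (simp add: l)
    ultimately have "prob {\<omega> \<in> space M. f u2 + t < X \<omega>} < exp (- x)"
      by (meson exp_less_mono le_less_trans)
    moreover have "{\<omega> \<in> space M. X \<omega> / real n \<le> oracle_risk 2 n \<sigma> \<mu> u2 + 4 * \<sigma>\<^sup>2 * x / real n}
        = space M - {\<omega> \<in> space M. f u2 + t < X \<omega>}"
      unfolding risk t_def add_divide_distrib[symmetric] using n by (auto simp: divide_le_cancel not_less add.assoc)
    moreover have "prob (space M - {\<omega> \<in> space M. f u2 + t < X \<omega>}) = 1 - prob {\<omega> \<in> space M. f u2 + t < X \<omega>}"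
      by (rule prob_compl) measurable
    ultimately show ?thesis by simp
  qed
  show ?thesis
    unfolding loss using int expect prob u1 u2 by auto
qed

end
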